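(* Let $B^{(\mu)}=\{B^{(\mu)}_t : t\ge 0\}$ be a Brownian motion with drift $\mu>0$ started from $x\in\mathbb{R}$ (i.e. $B^{(\mu)}_t=x+W_t+\mu t$ with $W$ a standard one-dimensional Brownian motion started from $0$), and let $\mathbf{E}_x$ denote the corresponding expectation. Let $c>0$, $\theta>0$, and let $p,q$ be real numbers with $p\ge 0$ and $p+q\ge 0$. Put $$I_\infty(p,q):=\int_0^\infty\Big(\frac{p}{c\exp(\theta B^{(\mu)}_s)+1}+\frac{q}{(c\exp(\theta B^{(\mu)}_s)+1)^2}\Big)\,ds .$$ Then $$\mathbf{E}_x\big(\exp(-I_\infty(p,q))\big)=K\,v(x)^k\,F\big(\alpha,\beta,\alpha+\beta+2\mu/\theta;\,v(x)\big),$$ where $F$ is Gauss' hypergeometric function, $$\alpha=\frac12-\frac{\mu}{\theta}+\frac{\sqrt{\mu^2+2(p+q)}}{\theta}+\frac12\sqrt{1+\frac{8q}{\theta^2}},\qquad \beta=\frac12-\frac{\mu}{\theta}+\frac{\sqrt{\mu^2+2(p+q)}}{\theta}-\frac12\sqrt{1+\frac{8q}{\theta^2}},$$ $$k=\frac{\alpha+\beta-1}{2},\qquad v(x)=\frac{c\exp(\theta x)}{c\exp(\theta x)+1},\qquad K=\frac{\Gamma(\alpha+2\mu/\theta)\,\Gamma(\beta+2\mu/\theta)}{\Gamma(\alpha+\beta+2\mu/\theta)\,\Gamma(2\mu/\theta)} .$$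
   Context: Gauss' hypergeometric function is, for $0<x<1$, $$F(\alpha,\beta,\gamma;x)=\frac{\Gamma(\gamma)}{\Gamma(\beta)\Gamma(\alpha)}\sum_{n=0}^\infty\frac{\Gamma(\alpha+n)\Gamma(\beta+n)}{\Gamma(\gamma+n)}\frac{x^n}{n!},$$ that is, $\sum_{n\ge0}\frac{(\alpha)_n(\beta)_n}{(\gamma)_n}\frac{x^n}{n!}$ with $(a)_0=1$, $(a)_n=a(a+1)\cdots(a+n-1)$; the latter form gives the meaning also when $\alpha$ or $\beta$ is a non-positive integer (e.g. $F(\alpha,0,\gamma;x)=1$). The parameter $\gamma$ is real, while $\alpha,\beta$ may be real or complex conjugates of each other. When $1+8q/\theta^2<0$, its square root is taken to be purely imaginary, so that $\alpha$ and $\beta$ are complex conjugates (the formula is symmetric in $\alpha$ and $\beta$, so the choice of the root is irrelevant). *)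

theory Defs
  imports "HOL-Probability.Probability" "HOL-Complex_Analysis.Complex_Analysis"
begin

(* Paths are continuous for every outcome, not just almost surely, so that path integrals are
   random variables even when M is not complete. *)
locale standard_brownian_motion = prob_space M
  for M :: "'a measure" and W :: "real \<Rightarrow> 'a \<Rightarrow> real" +
  assumes random_variable_W: "0 \<le> t \<Longrightarrow> random_variable borel (W t)"
    and start_zero: "AE \<omega> in M. W 0 \<omega> = 0"
    and independent_increments:
      "0 \<le> ts 0 \<Longrightarrow> mono_on {..n} ts \<Longrightarrow>
        indep_vars (\<lambda>_. borel) (\<lambda>i \<omega>. W (ts (Suc i)) \<omega> - W (ts i) \<omega>) {..<n::nat}"
    and gaussian_increments:
      "0 \<le> s \<Longrightarrow> s < t \<Longrightarrow>
        distributed M lborel (\<lambda>\<omega>. W t \<omega> - W s \<omega>) (normal_density 0 (sqrt (t - s)))"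
    and continuous_paths: "\<omega> \<in> space M \<Longrightarrow> continuous_on {0..} (\<lambda>t. W t \<omega>)"

definition brownian_motion_with_drift ::
    "'a measure \<Rightarrow> real \<Rightarrow> real \<Rightarrow> (real \<Rightarrow> 'a \<Rightarrow> real) \<Rightarrow> bool" where
  "brownian_motion_with_drift M \<mu> x B \<longleftrightarrow>
    (\<exists>W. standard_brownian_motion M W \<and>
         (\<forall>t\<ge>0. \<forall>\<omega>\<in>space M. B t \<omega> = x + W t \<omega> + \<mu> * t))"

(* Under the drift and sign conditions of the theorem, the integrand is nonnegative and almost
   surely integrable, so the default value of the Bochner integral plays no role. *)
definition I_infty :: "real \<Rightarrow> real \<Rightarrow> (real \<Rightarrow> 'a \<Rightarrow> real) \<Rightarrow> real \<Rightarrow> real \<Rightarrow> 'a \<Rightarrow> real" where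
  "I_infty c \<theta> B p q \<omega> =
    (LINT s:{0..}|lborel. p / (c * exp (\<theta> * B s \<omega>) + 1) + q / (c * exp (\<theta> * B s \<omega>) + 1)\<^sup>2)"

definition gauss_F :: "complex \<Rightarrow> complex \<Rightarrow> complex \<Rightarrow> complex \<Rightarrow> complex" where
  "gauss_F \<alpha> \<beta> \<gamma> x =
    (\<Sum>n. pochhammer \<alpha> n * pochhammer \<beta> n / pochhammer \<gamma> n * x ^ n / fact n)"

lemma gauss_F_Gamma:
  assumes "\<alpha> \<notin> \<int>\<^sub>\<le>\<^sub>0" "\<beta> \<notin> \<int>\<^sub>\<le>\<^sub>0" "\<gamma> \<notin> \<int>\<^sub>\<le>\<^sub>0"
    and "summable (\<lambda>n. Gamma (\<alpha> + of_nat n) * Gamma (\<beta> + of_nat n) / Gamma (\<gamma> + of_nat n) * x ^ n / fact n)"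
  shows "gauss_F \<alpha> \<beta> \<gamma> x = Gamma \<gamma> / (Gamma \<beta> * Gamma \<alpha>) *
    (\<Sum>n. Gamma (\<alpha> + of_nat n) * Gamma (\<beta> + of_nat n) / Gamma (\<gamma> + of_nat n) * x ^ n / fact n)"
  unfolding gauss_F_def suminf_mult[OF assms(4), symmetric]
  using assms(1-3) by (intro suminf_cong) (simp add: pochhammer_Gamma Gamma_eq_zero_iff mult_ac)

end

(*
  Let V be the integrand of I_infty as a function of the position. In the variable v, the equation
  h'' / 2 + mu h' = V h becomes the hypergeometric equation, so that h = v^k F(v) is a bounded
  solution, and h(B_t) exp (- int_0^t V(B_s) ds) should have constant expectation h(x). Ito's
  formula is avoided by discretising time: on a grid of width d, a third-order Taylor expansion and
  the independence of the increments show that one step changes the expectation by O(d^(3/2)), so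
  the total error over [0, t] vanishes as d tends to 0. As t tends to infinity, B_t tends to
  infinity and v(B_t) to 1, whence E exp (- I_infty) F(1) = h(x); Gauss' summation theorem gives
  F(1) = 1 / K.
*)
theory Submission
  imports Defs
begin

section \<open>Gauss' summation theorem\<close>

text \<open>Positivity of the drift enters twice. Since \<gamma> - \<alpha> - \<beta> =
  2\<mu>/\<theta> > 0, the hypergeometric series converges absolutely at v = 1, which makes h
  bounded with a limit at infinity. And E exp(-\<epsilon> B_t) decays exponentially for 0 <
  \<epsilon> < 2\<mu>; this one moment yields both the finiteness of the integral and the escape of
  B to infinity. The exponent k comes from the other end: as y tends to -infinity the potential
  tends to p + q, so h behaves like exp(\<theta> k y) with (\<theta> k + \<mu>)^2 = \<mu>^2 + 2(p +
  q), and boundedness selects the root k >= 0. The obstacle to the Taylor estimate is that F' may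
  blow up at v = 1 (like (1 - v)^(2\<mu>/\<theta> - 1) when 2\<mu> < \<theta>). The derivatives of h
  are therefore bounded through the equation that h solves, starting from the bound on h alone.
  Complex parameters are confined to the coefficients and the Gamma factors: \<alpha> + \<beta> and
  \<alpha>\<beta> are real, and the analysis runs over the reals.\<close>

definition hyp_coeff :: "complex \<Rightarrow> complex \<Rightarrow> complex \<Rightarrow> nat \<Rightarrow> complex" where
  "hyp_coeff a b c n = pochhammer a n * pochhammer b n / (pochhammer c n * fact n)"

lemma gauss_F_hyp_coeff: "gauss_F a b c z = (\<Sum>n. hyp_coeff a b c n * z ^ n)"
  by (simp add: gauss_F_def hyp_coeff_def)

lemma hyp_coeff_0 [simp]: "hyp_coeff a b c 0 = 1"
  by (simp add: hyp_coeff_def)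

lemma hyp_coeff_Suc:
  "hyp_coeff a b c (Suc n) =
     hyp_coeff a b c n * ((a + of_nat n) * (b + of_nat n) / ((c + of_nat n) * of_nat (Suc n)))"
  by (simp add: hyp_coeff_def pochhammer_Suc mult_ac)

text \<open>The coefficient is a quotient of the products behind \<open>rGamma_series\<close> and
  \<open>Gamma_series\<close>. These involve \<open>pochhammer\<close> at n + 1, hence the index
  \<open>Suc n\<close>. Thus the n-th coefficient is at most of order n^(a + b - c - 1).\<close>

lemma hyp_coeff_Suc_asymp:
  "(\<lambda>n. hyp_coeff a b c (Suc n) * of_nat (Suc n) * exp ((c - a - b) * of_real (ln (of_nat n))))
     \<longlonglongrightarrow> rGamma a * rGamma b * Gamma c"
proof -
  have "hyp_coeff a b c (Suc n) * of_nat (Suc n) * exp ((c - a - b) * of_real (ln (of_nat n)))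
      = rGamma_series a n * rGamma_series b n * Gamma_series c n" for n
    unfolding hyp_coeff_def rGamma_series_def Gamma_series_def Suc_eq_plus1
    by (simp add: exp_diff ring_distribs left_diff_distrib divide_simps del: of_nat_Suc)
  then show ?thesis
    by (auto intro!: tendsto_intros)
qed

lemma hyp_coeff_bound:
  obtains C where "\<And>n. 0 < n \<Longrightarrow> norm (hyp_coeff a b c (Suc n)) * real (Suc n) \<le> C * real n powr (- Re (c - a - b))"
proof -
  obtain C where C: "\<And>n. norm (hyp_coeff a b c (Suc n) * of_nat (Suc n)
      * exp ((c - a - b) * of_real (ln (of_nat n)))) \<le> C"
    using convergent_imp_Bseq[OF convergentI[OF hyp_coeff_Suc_asymp[of a b c]]]
    by (auto simp: Bseq_def)
  have "norm (hyp_coeff a b c (Suc n)) * real (Suc n) \<le> C * real n powr (- Re (c - a - b))"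
    if "0 < n" for n
  proof -
    have "norm (hyp_coeff a b c (Suc n)) * real (Suc n) * real n powr Re (c - a - b) \<le> C"
      using C[of n] that
      by (simp add: norm_mult norm_exp_eq_Re powr_def mult_ac del: of_nat_Suc)
    then show ?thesis
      using that by (simp only: powr_minus divide_inverse[symmetric]) (simp add: pos_le_divide_eq del: of_nat_Suc)
  qed
  then show ?thesis using that by blast
qed

text \<open>The coefficients are O(n^(-1 - Re (c - a - b))), so both parts hold exactly in the range
  that Gauss' theorem covers. The second part removes the boundary term of the telescoping sum in
  \<open>hyp_coeff_sum_contiguous\<close>.\<close>

lemma
  assumes "0 < Re (c - a - b)"
  shows summable_norm_hyp_coeff: "summable (\<lambda>n. norm (hyp_coeff a b c n))"
    and hyp_coeff_mult_tendsto_0: "(\<lambda>n. of_nat n * hyp_coeff a b c n) \<longlonglongrightarrow> 0"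
proof -
  obtain C where C: "\<And>n. 0 < n \<Longrightarrow>
      norm (hyp_coeff a b c (Suc n)) * real (Suc n) \<le> C * real n powr (- Re (c - a - b))"
    using hyp_coeff_bound[of a b c] by blast
  have "summable (\<lambda>n. norm (hyp_coeff a b c (Suc n)))"
  proof (rule summable_comparison_test_ev)
    show "\<forall>\<^sub>F n in sequentially. norm (norm (hyp_coeff a b c (Suc n)))
        \<le> C * real n powr (- 1 - Re (c - a - b))"
      using eventually_gt_at_top[of 0]
    proof eventually_elim
      case (elim n)
      have "norm (hyp_coeff a b c (Suc n)) * real n \<le> norm (hyp_coeff a b c (Suc n)) * real (Suc n)"
        by (intro mult_left_mono) auto
      also note C[OF elim]
      finally show ?case
        using elim by (simp add: powr_diff powr_minus divide_simps mult_ac)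
    qed
    show "summable (\<lambda>n. C * real n powr (- 1 - Re (c - a - b)))"
      using assms by (intro summable_mult) (simp add: summable_real_powr_iff)
  qed
  then show "summable (\<lambda>n. norm (hyp_coeff a b c n))"
    by (rule summable_Suc_iff[THEN iffD1])
  have "(\<lambda>n. of_nat (Suc n) * hyp_coeff a b c (Suc n)) \<longlonglongrightarrow> 0"
  proof (rule Lim_null_comparison)
    show "\<forall>\<^sub>F n in sequentially. norm (of_nat (Suc n) * hyp_coeff a b c (Suc n))
        \<le> C * real n powr (- Re (c - a - b))"
      using eventually_gt_at_top[of 0]
      by eventually_elim (use C in \<open>simp add: norm_mult mult.commute del: of_nat_Suc\<close>)
    show "(\<lambda>n. C * real n powr (- Re (c - a - b))) \<longlonglongrightarrow> 0"
      using assms by (intro tendsto_mult_right_zero tendsto_neg_powr filterlim_real_sequentially) auto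
  qed
  then show "(\<lambda>n. of_nat n * hyp_coeff a b c n) \<longlonglongrightarrow> 0"
    by (rule LIMSEQ_imp_Suc)
qed

lemma add_of_nat_neq_0: "0 < Re c \<Longrightarrow> c + of_nat n \<noteq> 0"
  by (auto simp: complex_eq_iff)

lemma hyp_coeff_shift:
  assumes "0 < Re c"
  shows "hyp_coeff a b (c + 1) n = hyp_coeff a b c n * (c / (c + of_nat n))"
proof (induction n)
  case 0
  then show ?case using assms by auto
next
  case (Suc n)
  have "c + of_nat n \<noteq> 0" "c + of_nat (Suc n) \<noteq> 0"
    using add_of_nat_neq_0[OF assms] by blast+
  then show ?case
    unfolding hyp_coeff_Suc Suc.IH by (simp add: add_ac mult_ac)
qed

text \<open>This contiguous relation at argument 1 is the engine of Gauss' own proof: raising c by 1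
  repeatedly moves the sum towards the trivial case c = infinity, while the factors split off build
  up the Gamma functions.\<close>

lemma hyp_coeff_sum_contiguous:
  assumes "0 < Re c" "0 < Re (c - a - b)"
  shows "c * (c - a - b) * (\<Sum>n. hyp_coeff a b c n)
       = (c - a) * (c - b) * (\<Sum>n. hyp_coeff a b (c + 1) n)"
proof -
  \<comment> \<open>\<open>G\<close> telescopes the difference of the two sides termwise.\<close>
  define G where "G n = - c * (of_nat n * hyp_coeff a b c n)" for n
  have "G \<longlonglongrightarrow> - c * 0"
    unfolding G_def using hyp_coeff_mult_tendsto_0[OF assms(2)] by (intro tendsto_intros)
  then have "(\<lambda>n. G (Suc n) - G n) sums (0 - G 0)"
    by (intro telescope_sums) simp
  also have "(\<lambda>n. G (Suc n) - G n) =
     (\<lambda>n. c * (c - a - b) * hyp_coeff a b c n - (c - a) * (c - b) * hyp_coeff a b (c + 1) n)"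
  proof
    fix n
    have "c + of_nat n \<noteq> 0"
      using add_of_nat_neq_0[OF assms(1)] .
    moreover have "(1 + of_nat n :: complex) \<noteq> 0"
      using of_nat_neq_0[of n, where ?'a = complex] by simp
    ultimately show "G (Suc n) - G n =
        c * (c - a - b) * hyp_coeff a b c n - (c - a) * (c - b) * hyp_coeff a b (c + 1) n"
      unfolding G_def hyp_coeff_Suc hyp_coeff_shift[OF assms(1)]
      by (simp add: divide_simps) algebra
  qed
  finally have "(\<lambda>n. c * (c - a - b) * hyp_coeff a b c n
      - (c - a) * (c - b) * hyp_coeff a b (c + 1) n) sums 0"
    by (simp add: G_def)
  moreover have "(\<lambda>n. c * (c - a - b) * hyp_coeff a b c n - (c - a) * (c - b) * hyp_coeff a b (c + 1) n)
      sums (c * (c - a - b) * (\<Sum>n. hyp_coeff a b c n)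
        - (c - a) * (c - b) * (\<Sum>n. hyp_coeff a b (c + 1) n))"
    using assms
    by (intro sums_diff sums_mult summable_sums summable_norm_cancel[OF summable_norm_hyp_coeff]) auto
  ultimately have "0 = c * (c - a - b) * (\<Sum>n. hyp_coeff a b c n)
        - (c - a) * (c - b) * (\<Sum>n. hyp_coeff a b (c + 1) n)"
    by (rule sums_unique2)
  then show ?thesis by simp
qed

lemma hyp_coeff_sum_iterate:
  assumes "0 < Re c" "0 < Re (c - a - b)"
  shows "pochhammer c m * pochhammer (c - a - b) m * (\<Sum>n. hyp_coeff a b c n)
       = pochhammer (c - a) m * pochhammer (c - b) m * (\<Sum>n. hyp_coeff a b (c + of_nat m) n)"
proof (induction m)
  case (Suc m)
  have *: "(c + of_nat m) * (c + of_nat m - a - b) * (\<Sum>n. hyp_coeff a b (c + of_nat m) n)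
     = (c + of_nat m - a) * (c + of_nat m - b) * (\<Sum>n. hyp_coeff a b (c + of_nat (Suc m)) n)"
    using hyp_coeff_sum_contiguous[of "c + of_nat m" a b] assms by (simp add: add_ac)
  have "pochhammer c (Suc m) * pochhammer (c - a - b) (Suc m) * (\<Sum>n. hyp_coeff a b c n)
     = (c + of_nat m) * (c + of_nat m - a - b) *
       (pochhammer c m * pochhammer (c - a - b) m * (\<Sum>n. hyp_coeff a b c n))"
    by (simp add: pochhammer_Suc algebra_simps)
  also have "\<dots> = pochhammer (c - a) m * pochhammer (c - b) m *
     ((c + of_nat m) * (c + of_nat m - a - b) * (\<Sum>n. hyp_coeff a b (c + of_nat m) n))"
    unfolding Suc.IH by (simp only: mult_ac)
  also have "\<dots> = pochhammer (c - a) (Suc m) * pochhammer (c - b) (Suc m) *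
      (\<Sum>n. hyp_coeff a b (c + of_nat (Suc m)) n)"
    unfolding * by (simp add: pochhammer_Suc algebra_simps)
  finally show ?case .
qed simp

text \<open>Each factor (a + n)(b + n) / ((c + m + n)(n + 1)) tends to 0 as m grows, so only the
  constant term survives. As Re c > 0, shifting c to the right never increases a modulus, and the
  coefficients for m = 0 dominate.\<close>

lemma hyp_coeff_sum_tendsto_1:
  assumes "0 < Re c" "0 < Re (c - a - b)"
  shows "(\<lambda>m. \<Sum>n. hyp_coeff a b (c + of_nat m) n) \<longlonglongrightarrow> 1"
proof -
  have coeff_le: "norm (hyp_coeff a b (c + of_nat m) n) \<le> norm (hyp_coeff a b c n)" for m n
  proof (induction n)
    case (Suc n)
    have "norm (c + of_nat n) \<le> norm (c + of_nat m + of_nat n)"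
      using assms(1) by (auto simp: cmod_def intro!: real_sqrt_le_mono power_mono)
    moreover have "0 < norm (c + of_nat n)"
      using add_of_nat_neq_0[OF assms(1)] by simp
    ultimately show ?case
      unfolding hyp_coeff_Suc norm_mult norm_divide
      by (intro mult_mono divide_left_mono mult_right_mono Suc.IH mult_pos_pos) (auto intro!: mult_pos_pos simp del: of_nat_Suc)
  qed simp
  have coeff_lim: "(\<lambda>m. hyp_coeff a b (c + of_nat m) n) \<longlonglongrightarrow> (if n = 0 then 1 else 0)" for n
  proof (induction n)
    case (Suc n)
    have "filterlim (\<lambda>m. (c + of_nat n) + of_nat m) at_infinity sequentially"
      by (rule tendsto_add_filterlim_at_infinity[OF tendsto_const tendsto_of_nat])
    then have "(\<lambda>m. ((a + of_nat n) * (b + of_nat n) / of_nat (Suc n)) / ((c + of_nat n) + of_nat m)) \<longlonglongrightarrow> 0"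
      by (rule tendsto_divide_0[OF tendsto_const])
    from tendsto_mult[OF Suc.IH this] show ?case
      by (simp add: hyp_coeff_Suc add_ac mult_ac)
  qed simp
  have "(\<lambda>m. \<Sum>n. hyp_coeff a b (c + of_nat m) n) \<longlonglongrightarrow> (\<Sum>n. if n = 0 then 1 else 0)"
    using tannerys_theorem[OF coeff_lim always_eventually summable_norm_hyp_coeff[OF assms(2)]] coeff_le
    by simp
  moreover have "(\<Sum>n. if n = 0 then 1 else 0) = (1 :: complex)"
    using sums_single[of 0 "\<lambda>_. 1 :: complex"] by (simp add: sums_iff)
  ultimately show ?thesis by simp
qed

text \<open>The iterated relation is regrouped into \<open>rGamma_series\<close>; the powers of n
  balance because c + (c - a - b) = (c - a) + (c - b). The form with \<open>rGamma\<close> covers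
  the poles of Gamma at c - a or c - b, where the sum is 0.\<close>

theorem gauss_summation:
  assumes "0 < Re c" "0 < Re (c - a - b)"
  shows "(\<Sum>n. hyp_coeff a b c n) * (rGamma c * rGamma (c - a - b)) = rGamma (c - a) * rGamma (c - b)"
proof -
  let ?F = "\<lambda>c. \<Sum>n. hyp_coeff a b c n"
  have "?F c * (rGamma_series c n * rGamma_series (c - a - b) n)
     = rGamma_series (c - a) n * rGamma_series (c - b) n * ?F (c + of_nat (Suc n))" for n
    using hyp_coeff_sum_iterate[OF assms, of "Suc n"]
    unfolding rGamma_series_def Suc_eq_plus1
    by (simp add: exp_diff ring_distribs left_diff_distrib divide_simps mult_ac)
  moreover have "(\<lambda>n. ?F c * (rGamma_series c n * rGamma_series (c - a - b) n))
      \<longlonglongrightarrow> ?F c * (rGamma c * rGamma (c - a - b))"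
    by (intro tendsto_intros)
  moreover have "(\<lambda>n. rGamma_series (c - a) n * rGamma_series (c - b) n * ?F (c + of_nat (Suc n)))
      \<longlonglongrightarrow> rGamma (c - a) * rGamma (c - b) * 1"
    by (intro tendsto_mult rGamma_series_LIMSEQ LIMSEQ_Suc hyp_coeff_sum_tendsto_1 assms)
  ultimately show ?thesis
    using LIMSEQ_unique by fastforce
qed

section \<open>The hypergeometric equation\<close>

text \<open>Multiplication of a power series by its variable shifts the coefficients by one and
  leaves constant term 0.\<close>

lemma sums_case_Suc: "f sums S \<Longrightarrow> (\<lambda>n. case n of 0 \<Rightarrow> 0 | Suc m \<Rightarrow> f m) sums (S :: real)"
  using sums_Suc[of "\<lambda>n. case n of 0 \<Rightarrow> 0 | Suc m \<Rightarrow> f m" S] by simp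

text \<open>\<open>A\<close> stands for the coefficients of F(a, b, g; v) with \<open>s\<close> = a
  + b and \<open>r\<close> = a b: the product (a + n)(b + n) is written out, so that the locale
  stays real when a and b are complex conjugates.\<close>

locale hypergeometric_series =
  fixes A :: "nat \<Rightarrow> real" and s r g :: real
  assumes recurrence: "real (Suc n) * (g + real n) * A (Suc n) = ((real n)\<^sup>2 + s * real n + r) * A n"
    and abs_summable: "summable (\<lambda>n. \<bar>A n\<bar>)"
begin

definition f0 :: "real \<Rightarrow> real" where "f0 v = (\<Sum>n. A n * v ^ n)"
definition f1 :: "real \<Rightarrow> real" where "f1 v = (\<Sum>n. diffs A n * v ^ n)"
definition f2 :: "real \<Rightarrow> real" where "f2 v = (\<Sum>n. diffs (diffs A) n * v ^ n)"

lemma summable_f0: "norm v < 1 \<Longrightarrow> summable (\<lambda>n. A n * v ^ n)"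
  using abs_summable powser_inside[of A 1 v] by (simp add: summable_rabs_cancel)

lemma summable_f1: "norm v < 1 \<Longrightarrow> summable (\<lambda>n. diffs A n * v ^ n)"
  using termdiff_converges[of v 1 A] summable_f0 by simp

lemma summable_f2: "norm v < 1 \<Longrightarrow> summable (\<lambda>n. diffs (diffs A) n * v ^ n)"
  using termdiff_converges[of v 1 "diffs A"] summable_f1 by simp

lemma DERIV_f0: "norm v < 1 \<Longrightarrow> DERIV f0 v :> f1 v"
  unfolding f0_def[abs_def] f1_def using summable_f0 by (rule termdiffs_strong')

lemma DERIV_f1: "norm v < 1 \<Longrightarrow> DERIV f1 v :> f2 v"
  unfolding f1_def[abs_def] f2_def using summable_f1 by (rule termdiffs_strong')

text \<open>Comparison of coefficients: the left side contributes (n + 1)(g + n) A(n + 1) - (n^2 + s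
  n) A(n) to v^n, and the recurrence turns this into r A(n). The facts \<open>v1\<close>,
  \<open>v2\<close> and \<open>vv2\<close> are the series of v F', v F'' and v^2 F'' in powers
  v^n.\<close>

lemma hypergeometric_ode:
  assumes "norm v < 1"
  shows "v * (1 - v) * f2 v + (g - (s + 1) * v) * f1 v = r * f0 v"
proof -
  have 0: "(\<lambda>n. A n * v ^ n) sums f0 v" and 1: "(\<lambda>n. diffs A n * v ^ n) sums f1 v"
    and 2: "(\<lambda>n. diffs (diffs A) n * v ^ n) sums f2 v"
    unfolding f0_def f1_def f2_def
    using assms by (simp_all add: summable_sums summable_f0 summable_f1 summable_f2)
  have 1: "(\<lambda>n. real (Suc n) * A (Suc n) * v ^ n) sums f1 v"
    using 1 by (simp add: diffs_def)
  have "(\<lambda>n. v * (real (Suc n) * A (Suc n) * v ^ n)) sums (v * f1 v)"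
    using 1 by (rule sums_mult)
  from sums_case_Suc[OF this] have v1: "(\<lambda>n. real n * A n * v ^ n) sums (v * f1 v)"
    by (rule sums_cong[THEN iffD1, rotated]) (auto split: nat.split)
  have 2: "(\<lambda>n. real (Suc n) * real (Suc (Suc n)) * A (Suc (Suc n)) * v ^ n) sums f2 v"
    using 2 by (simp add: diffs_def mult_ac)
  have "(\<lambda>n. v * (real (Suc n) * real (Suc (Suc n)) * A (Suc (Suc n)) * v ^ n)) sums (v * f2 v)"
    using 2 by (rule sums_mult)
  from sums_case_Suc[OF this] have v2: "(\<lambda>n. real n * real (Suc n) * A (Suc n) * v ^ n) sums (v * f2 v)"
    by (rule sums_cong[THEN iffD1, rotated]) (auto split: nat.split)
  have "(\<lambda>n. v * (real n * real (Suc n) * A (Suc n) * v ^ n)) sums (v * (v * f2 v))"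
    using v2 by (rule sums_mult)
  from sums_case_Suc[OF this] have vv2: "(\<lambda>n. (real n - 1) * real n * A n * v ^ n) sums (v * (v * f2 v))"
    by (rule sums_cong[THEN iffD1, rotated]) (auto split: nat.split)
  have "(\<lambda>n. real n * real (Suc n) * A (Suc n) * v ^ n - (real n - 1) * real n * A n * v ^ n
      + (g * (real (Suc n) * A (Suc n) * v ^ n) - (s + 1) * (real n * A n * v ^ n)))
     sums (v * f2 v - v * (v * f2 v) + (g * f1 v - (s + 1) * (v * f1 v)))"
    by (intro sums_add sums_diff sums_mult v2 vv2 1 v1)
  also have "(\<lambda>n. real n * real (Suc n) * A (Suc n) * v ^ n - (real n - 1) * real n * A n * v ^ n
      + (g * (real (Suc n) * A (Suc n) * v ^ n) - (s + 1) * (real n * A n * v ^ n)))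
    = (\<lambda>n. r * (A n * v ^ n))"
  proof
    fix n
    have "real n * real (Suc n) * A (Suc n) * v ^ n - (real n - 1) * real n * A n * v ^ n
      + (g * (real (Suc n) * A (Suc n) * v ^ n) - (s + 1) * (real n * A n * v ^ n))
      = (real (Suc n) * (g + real n) * A (Suc n)) * v ^ n
        - ((real n)\<^sup>2 + s * real n) * A n * v ^ n"
      by (simp add: algebra_simps power2_eq_square)
    also have "\<dots> = r * (A n * v ^ n)"
      unfolding recurrence by (simp add: algebra_simps)
    finally show "real n * real (Suc n) * A (Suc n) * v ^ n - (real n - 1) * real n * A n * v ^ n
      + (g * (real (Suc n) * A (Suc n) * v ^ n) - (s + 1) * (real n * A n * v ^ n))
      = r * (A n * v ^ n)" .
  qed
  finally have "(\<lambda>n. r * (A n * v ^ n)) sums (v * f2 v - v * (v * f2 v) + (g * f1 v - (s + 1) * (v * f1 v)))" .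
  moreover have "(\<lambda>n. r * (A n * v ^ n)) sums (r * f0 v)"
    using 0 by (rule sums_mult)
  ultimately have "v * f2 v - v * (v * f2 v) + (g * f1 v - (s + 1) * (v * f1 v)) = r * f0 v"
    by (rule sums_unique2)
  then show ?thesis by (simp add: algebra_simps)
qed

lemma term_le: "v \<in> {0..1} \<Longrightarrow> norm (A n * v ^ n) \<le> \<bar>A n\<bar>"
  by (auto simp: abs_mult intro!: mult_left_le power_le_one)

lemma f0_bound:
  assumes "v \<in> {0..1}"
  shows "\<bar>f0 v\<bar> \<le> (\<Sum>n. \<bar>A n\<bar>)"
proof -
  have "summable (\<lambda>n. norm (A n * v ^ n))"
    using term_le[OF assms] abs_summable by (intro summable_comparison_test'[OF abs_summable]) auto
  then have "norm (f0 v) \<le> (\<Sum>n. norm (A n * v ^ n))"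
    unfolding f0_def by (rule summable_norm)
  also have "\<dots> \<le> (\<Sum>n. \<bar>A n\<bar>)"
    by (intro suminf_le term_le[OF assms] abs_summable) fact
  finally show ?thesis by simp
qed

text \<open>The endpoint 1 is the point of this lemma: it lies on the circle of convergence and is
  the limit of v along paths escaping to infinity. Absolute summability gives uniform convergence up
  to it.\<close>

lemma continuous_f0: "continuous_on {0..1} f0"
  unfolding f0_def[abs_def]
proof (rule uniform_limit_theorem)
  show "uniform_limit {0..1} (\<lambda>n v. \<Sum>i<n. A i * v ^ i) (\<lambda>v. \<Sum>i. A i * v ^ i) sequentially"
    by (rule Weierstrass_m_test[OF term_le abs_summable])
qed (auto intro!: continuous_intros always_eventually)

end

section \<open>The potential and its equation in the logistic variable v\<close>

locale logistic_potential =
  fixes c \<theta> \<mu> p q :: real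
  assumes c_pos: "0 < c" and theta_pos: "0 < \<theta>"
begin

definition v :: "real \<Rightarrow> real" where
  "v y = c * exp (\<theta> * y) / (c * exp (\<theta> * y) + 1)"

definition V :: "real \<Rightarrow> real" where
  "V y = p / (c * exp (\<theta> * y) + 1) + q / (c * exp (\<theta> * y) + 1)\<^sup>2"

lemma denom_pos: "0 < c * exp (\<theta> * y) + 1"
  using c_pos by (intro add_pos_pos mult_pos_pos) auto

lemma one_minus_v: "1 - v y = 1 / (c * exp (\<theta> * y) + 1)"
  using denom_pos[of y] by (simp add: v_def field_simps)

lemma v_gt_0: "0 < v y"
  using denom_pos[of y] c_pos by (simp add: v_def)

lemma v_lt_1: "v y < 1"
  using one_minus_v[of y] denom_pos[of y] by (smt (verit) divide_pos_pos)

lemma DERIV_v: "(v has_real_derivative \<theta> * v y * (1 - v y)) (at y)"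
proof -
  have "((\<lambda>y. 1 - 1 / (c * exp (\<theta> * y) + 1)) has_real_derivative \<theta> * v y * (1 - v y)) (at y)"
    unfolding one_minus_v unfolding v_def using denom_pos[of y]
    by (auto intro!: derivative_eq_intros simp: power2_eq_square)
  also have "(\<lambda>y. 1 - 1 / (c * exp (\<theta> * y) + 1)) = v"
    using one_minus_v by (auto simp: fun_eq_iff algebra_simps)
  finally show ?thesis .
qed

lemma V_eq: "V y = p * (1 - v y) + q * (1 - v y)\<^sup>2"
  unfolding one_minus_v V_def by (simp add: power_divide)

text \<open>The factor p + q(1 - v) is the convex combination of p and p + q with weights v and 1 -
  v.\<close>

lemma V_nonneg: "0 \<le> p \<Longrightarrow> 0 \<le> p + q \<Longrightarrow> 0 \<le> V y"
proof -
  assume *: "0 \<le> p" "0 \<le> p + q"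
  have "0 \<le> (1 - v y) * (v y * p + (1 - v y) * (p + q))"
    using * v_gt_0[of y] v_lt_1[of y]
    by (intro mult_nonneg_nonneg[of "1 - v y"] add_nonneg_nonneg[of "v y * p"]) simp_all
  also have "\<dots> = V y"
    unfolding V_eq by (simp add: algebra_simps power2_eq_square)
  finally show ?thesis .
qed

lemma abs_V_le: "\<bar>V y\<bar> \<le> (\<bar>p\<bar> + \<bar>q\<bar>) * (1 - v y)"
proof -
  have "\<bar>V y\<bar> = (1 - v y) * \<bar>p + q * (1 - v y)\<bar>"
    using abs_mult[of "1 - v y" "p + q * (1 - v y)"] v_lt_1[of y]
    by (simp add: V_eq distrib_left power2_eq_square mult_ac)
  also have "\<dots> \<le> (1 - v y) * (\<bar>p\<bar> + \<bar>q\<bar>)"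
    using v_lt_1[of y] v_gt_0[of y]
    by (intro mult_left_mono order.trans[OF abs_triangle_ineq] add_mono)
       (auto simp: abs_mult intro!: mult_left_le)
  finally show ?thesis by (simp add: mult.commute)
qed

text \<open>The natural decay rate of \<open>V\<close> is \<open>\<theta>\<close>, but
  exp(-\<epsilon> B_t) has a decaying expectation only for \<epsilon> < 2\<mu>. Since 1 - v lies in
  (0, 1), raising it to the power \<epsilon>/\<theta> <= 1 trades the rate for a smaller
  one.\<close>

lemma V_exp_bound:
  assumes "0 < \<epsilon>" "\<epsilon> \<le> \<theta>"
  shows "V y \<le> ((\<bar>p\<bar> + \<bar>q\<bar>) * c powr (- \<epsilon> / \<theta>)) * exp (- \<epsilon> * y)"
proof -
  have "1 - v y \<le> (1 - v y) powr (\<epsilon> / \<theta>)"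
    using powr_mono'[of "\<epsilon> / \<theta>" 1 "1 - v y"] v_lt_1[of y] v_gt_0[of y] assms by simp
  also have "\<dots> \<le> (1 / (c * exp (\<theta> * y))) powr (\<epsilon> / \<theta>)"
    unfolding one_minus_v using c_pos assms denom_pos[of y]
    by (intro powr_mono2 divide_left_mono) auto
  also have "\<dots> = c powr (- \<epsilon> / \<theta>) * exp (- \<epsilon> * y)"
    using c_pos assms
    by (simp add: powr_divide powr_mult powr_minus_divide) (simp add: powr_def exp_minus divide_inverse)
  finally have "1 - v y \<le> c powr (- \<epsilon> / \<theta>) * exp (- \<epsilon> * y)" .
  then have "(\<bar>p\<bar> + \<bar>q\<bar>) * (1 - v y) \<le> (\<bar>p\<bar> + \<bar>q\<bar>) * (c powr (- \<epsilon> / \<theta>) * exp (- \<epsilon> * y))"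
    by (intro mult_left_mono) auto
  with abs_V_le[of y] show ?thesis by (simp add: mult.assoc)
qed

lemma DERIV_V: "(V has_real_derivative - \<theta> * v y * (1 - v y) * (p + 2 * q * (1 - v y))) (at y)"
  unfolding V_eq[abs_def]
  by (auto intro!: derivative_eq_intros DERIV_v simp: algebra_simps power2_eq_square)

lemma DERIV_V_bound: "\<bar>- \<theta> * v y * (1 - v y) * (p + 2 * q * (1 - v y))\<bar> \<le> \<theta> * (\<bar>p\<bar> + 2 * \<bar>q\<bar>)"
proof -
  have "\<bar>- \<theta> * v y * (1 - v y) * (p + 2 * q * (1 - v y))\<bar>
      = \<theta> * (v y * (1 - v y)) * \<bar>p + 2 * q * (1 - v y)\<bar>"
    using v_lt_1[of y] v_gt_0[of y] theta_pos by (simp add: abs_mult)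
  also have "\<dots> \<le> \<theta> * 1 * (\<bar>p\<bar> + 2 * \<bar>q\<bar>)"
    using v_lt_1[of y] v_gt_0[of y] theta_pos
    by (intro mult_mono order.trans[OF abs_triangle_ineq] add_mono mult_le_one)
       (auto simp: abs_mult intro!: mult_left_le)
  finally show ?thesis by simp
qed

lemma v_tendsto_1: "(v \<longlongrightarrow> 1) at_top"
proof -
  have "filterlim (\<lambda>y. c * exp (\<theta> * y) + 1) at_top at_top"
    using c_pos theta_pos by real_asymp
  then have "((\<lambda>y. 1 - 1 / (c * exp (\<theta> * y) + 1)) \<longlongrightarrow> 1 - 0) at_top"
    by (intro tendsto_diff tendsto_const tendsto_divide_0[OF tendsto_const])
       (rule filterlim_at_top_imp_at_infinity)
  also have "(\<lambda>y. 1 - 1 / (c * exp (\<theta> * y) + 1)) = v"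
    using one_minus_v by (auto simp: fun_eq_iff algebra_simps)
  finally show ?thesis by simp
qed

text \<open>With v' = \<theta> v (1 - v), the generator becomes an operator with singular points at
  v = 0 and v = 1. Condition \<open>k\<close> is the indicial equation at v = 0; splitting off v^k
  then leaves the hypergeometric equation with \<gamma> = 2k + 1 + 2\<mu>/\<theta>, \<alpha> +
  \<beta> = 2k + 1 and \<alpha>\<beta> = k^2 + k - 2q/\<theta>^2.\<close>

lemma ode_solution:
  fixes f0 f1 f2 :: "real \<Rightarrow> real" and k :: real
  assumes k: "(\<theta> * k + \<mu>)\<^sup>2 = \<mu>\<^sup>2 + 2 * (p + q)"
    and f0: "\<And>z. 0 < z \<Longrightarrow> z < 1 \<Longrightarrow> (f0 has_real_derivative f1 z) (at z)"
    and f1: "\<And>z. 0 < z \<Longrightarrow> z < 1 \<Longrightarrow> (f1 has_real_derivative f2 z) (at z)"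
    and ode: "\<And>z. 0 < z \<Longrightarrow> z < 1 \<Longrightarrow>
      z * (1 - z) * f2 z + (2 * k + 1 + 2 * \<mu> / \<theta> - (2 * k + 2) * z) * f1 z
        = (k\<^sup>2 + k - 2 * q / \<theta>\<^sup>2) * f0 z"
  defines "h \<equiv> \<lambda>y. v y powr k * f0 (v y)"
    and "h' \<equiv> \<lambda>y. \<theta> * (1 - v y) * v y powr k * (k * f0 (v y) + v y * f1 (v y))"
  shows "(h has_real_derivative h' y) (at y)"
    and "(h' has_real_derivative 2 * (V y * h y - \<mu> * h' y)) (at y)"
proof -
  note v01 = v_gt_0[of y] v_lt_1[of y]
  have E: "((\<lambda>y. v y powr k) has_real_derivative k * \<theta> * (1 - v y) * v y powr k) (at y)"
  proof -
    have "((\<lambda>y. v y powr k) has_real_derivative k * v y powr (k - 1) * (\<theta> * v y * (1 - v y))) (at y)"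
      using DERIV_fun_powr[OF DERIV_v v01(1), of k] by simp
    also have "v y powr (k - 1) = v y powr k / v y"
      using v01 by (simp add: powr_diff)
    finally show ?thesis using v01 by (simp add: mult_ac)
  qed
  have F0: "((\<lambda>y. f0 (v y)) has_real_derivative f1 (v y) * (\<theta> * v y * (1 - v y))) (at y)"
    using DERIV_chain2[OF f0[OF v01] DERIV_v] .
  have F1: "((\<lambda>y. f1 (v y)) has_real_derivative f2 (v y) * (\<theta> * v y * (1 - v y))) (at y)"
    using DERIV_chain2[OF f1[OF v01] DERIV_v] .
  show "(h has_real_derivative h' y) (at y)"
    unfolding h_def h'_def using DERIV_mult[OF E F0] by (simp add: algebra_simps)
  \<comment> \<open>Scaling by \<open>\<theta>\<close> makes the remaining claims polynomial
    identities, free of division and hence within reach of \<open>algebra\<close>.\<close>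
  define m P Q where "m = \<mu> / \<theta>" and "P = 2 * p / \<theta>\<^sup>2" and "Q = 2 * q / \<theta>\<^sup>2"
  have mPQ: "\<mu> = m * \<theta>" "2 * p = P * \<theta>\<^sup>2" "2 * q = Q * \<theta>\<^sup>2"
    using theta_pos by (simp_all add: m_def P_def Q_def)
  have "\<theta>\<^sup>2 * (k\<^sup>2 + 2 * m * k) = \<theta>\<^sup>2 * (P + Q)"
    using k mPQ by algebra
  then have k': "k\<^sup>2 + 2 * m * k = P + Q"
    using theta_pos by simp
  have ode': "v y * (1 - v y) * f2 (v y) + (2 * k + 1 + 2 * m - (2 * k + 2) * v y) * f1 (v y)
        = (k\<^sup>2 + k - Q) * f0 (v y)"
    using ode[OF v01] by (simp add: m_def Q_def)
  define e where "e = (\<lambda>y. v y powr k)"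
  have E': "(e has_real_derivative k * \<theta> * (1 - v y) * e y) (at y)"
    using E by (simp add: e_def)
  have "((\<lambda>y. \<theta> * (1 - v y) * e y * (k * f0 (v y) + v y * f1 (v y))) has_real_derivative
      \<theta>\<^sup>2 * (1 - v y) * e y *
      (- v y * (k * f0 (v y) + v y * f1 (v y)) + k * (1 - v y) * (k * f0 (v y) + v y * f1 (v y))
       + v y * (1 - v y) * ((k + 1) * f1 (v y) + v y * f2 (v y)))) (at y)"
    by (auto intro!: derivative_eq_intros E' F0 F1 DERIV_v
        simp: algebra_simps power2_eq_square)
  also have "(\<lambda>y. \<theta> * (1 - v y) * e y * (k * f0 (v y) + v y * f1 (v y))) = h'"
    by (simp add: h'_def e_def)
  \<comment> \<open>The hypergeometric equation multiplied by v eliminates \<open>f2\<close>. The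
    terms in \<open>f1\<close> then agree, and those in \<open>f0\<close> agree by the indicial
    equation \<open>k'\<close>.\<close>
  also have "- v y * (k * f0 (v y) + v y * f1 (v y)) + k * (1 - v y) * (k * f0 (v y) + v y * f1 (v y))
       + v y * (1 - v y) * ((k + 1) * f1 (v y) + v y * f2 (v y))
      = (P + Q * (1 - v y)) * f0 (v y) - 2 * m * (k * f0 (v y) + v y * f1 (v y))"
    using ode' k' by algebra
  also have "\<theta>\<^sup>2 * (1 - v y) * e y *
       ((P + Q * (1 - v y)) * f0 (v y) - 2 * m * (k * f0 (v y) + v y * f1 (v y)))
     = 2 * (V y * h y - \<mu> * h' y)"
    unfolding V_eq h_def h'_def e_def using mPQ by algebra
  finally show "(h' has_real_derivative 2 * (V y * h y - \<mu> * h' y)) (at y)" .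
qed

end

section \<open>Riemann sums and Gaussian increments\<close>

text \<open>Left endpoints matter: they make the discount factor of a step depend only on the past,
  so that it is independent of the next increment.\<close>

lemma riemann_sum_tendsto_integral:
  fixes f :: "real \<Rightarrow> real"
  assumes "0 < t" and f: "continuous_on {0..t} f"
  shows "(\<lambda>n. t / real n * (\<Sum>j<n. f (real j * (t / real n)))) \<longlonglongrightarrow> integral {0..t} f"
proof (rule LIMSEQ_I)
  fix r :: real assume "0 < r"
  define e where "e = r / (2 * t)"
  have "0 < e" using \<open>0 < r\<close> \<open>0 < t\<close> by (simp add: e_def)
  moreover have "uniformly_continuous_on {0..t} f"
    using f by (rule compact_uniformly_continuous) simp
  ultimately obtain d where "0 < d"
    and d: "\<And>u w. u \<in> {0..t} \<Longrightarrow> w \<in> {0..t} \<Longrightarrow> dist w u < d \<Longrightarrow> dist (f w) (f u) < e"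
    unfolding uniformly_continuous_on_def by meson
  have "norm (t / real n * (\<Sum>j<n. f (real j * (t / real n))) - integral {0..t} f) < r"
    if n: "n \<ge> nat \<lceil>t / d\<rceil> + 1" for n
  proof -
    have n0: "0 < real n" using n by simp
    have "t / d < real n" using n by linarith
    define \<delta> where "\<delta> = t / real n"
    have \<delta>: "0 < \<delta>" "\<delta> < d" "real n * \<delta> = t"
      using \<open>0 < t\<close> n0 \<open>t / d < real n\<close> \<open>0 < d\<close> by (auto simp: \<delta>_def field_simps)
    have "\<bar>integral {0..real m * \<delta>} f - \<delta> * (\<Sum>j<m. f (real j * \<delta>))\<bar> \<le> real m * (\<delta> * e)"
      if "m \<le> n" for m
      using that
    proof (induction m)
      case (Suc m)
      let ?a = "real m * \<delta>" and ?b = "real (Suc m) * \<delta>"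
      have ab: "0 \<le> ?a" "?a \<le> ?b" "?b - ?a = \<delta>"
        using \<delta>(1) by (auto simp: algebra_simps)
      have "?b \<le> real n * \<delta>"
        using Suc.prems \<delta>(1) by (intro mult_right_mono) auto
      then have bt: "?b \<le> t" using \<delta> by simp
      have "{0..?b} \<subseteq> {0..t}" "{?a..?b} \<subseteq> {0..t}"
        using ab bt unfolding atLeastatMost_subset_iff by linarith+
      then have cont: "continuous_on {0..?b} f" "continuous_on {?a..?b} f"
        by (auto intro: continuous_on_subset[OF f])
      have "norm (integral {?a..?b} (\<lambda>u. f u - f ?a)) \<le> e * (?b - ?a)"
      proof (rule integral_bound)
        fix u assume u: "u \<in> {?a..?b}"
        have "?a \<in> {0..t}" "u \<in> {0..t}"
          using u ab bt unfolding atLeastAtMost_iff by linarith+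
        then have "dist (f u) (f ?a) < e"
        proof (rule d)
          show "dist u ?a < d" using u ab \<delta> by (auto simp: dist_real_def)
        qed
        then show "norm (f u - f ?a) \<le> e" by (simp add: dist_real_def)
      qed (use ab cont in \<open>auto intro!: continuous_intros\<close>)
      moreover have "integral {?a..?b} (\<lambda>u. f u - f ?a) = integral {?a..?b} f - \<delta> * f ?a"
        using ab cont
        by (subst Henstock_Kurzweil_Integration.integral_diff)
           (auto intro!: integrable_continuous_interval)
      moreover have "integral {0..?b} f = integral {0..?a} f + integral {?a..?b} f"
        by (rule Henstock_Kurzweil_Integration.integral_combine[symmetric, OF ab(1,2)
              integrable_continuous_interval[OF cont(1)]])
      ultimately show ?case
        using Suc ab(3) by (auto simp: algebra_simps abs_le_iff)
    qed simp
    from this[of n] have "\<bar>integral {0..t} f - \<delta> * (\<Sum>j<n. f (real j * \<delta>))\<bar> \<le> t * e"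
      using \<delta>(3) by (simp add: mult.assoc[symmetric])
    also have "t * e < r"
      using \<open>0 < r\<close> \<open>0 < t\<close> by (simp add: e_def)
    finally show ?thesis
      by (simp add: \<delta>_def abs_minus_commute)
  qed
  then show "\<exists>no. \<forall>n\<ge>no. norm (t / real n * (\<Sum>j<n. f (real j * (t / real n))) - integral {0..t} f) < r"
    by blast
qed

text \<open>Completing the square turns the integrand into a multiple of the normal density with
  mean a \<sigma>^2.\<close>

lemma normal_density_mgf:
  assumes "0 < \<sigma>"
  shows "has_bochner_integral lborel (\<lambda>z. normal_density 0 \<sigma> z * exp (a * z)) (exp (a\<^sup>2 * \<sigma>\<^sup>2 / 2))"
proof -
  have "normal_density 0 \<sigma> z * exp (a * z) = exp (a\<^sup>2 * \<sigma>\<^sup>2 / 2) * normal_density (a * \<sigma>\<^sup>2) \<sigma> z" for z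
  proof -
    have "- (z - 0)\<^sup>2 / (2 * \<sigma>\<^sup>2) + a * z = a\<^sup>2 * \<sigma>\<^sup>2 / 2 + - (z - a * \<sigma>\<^sup>2)\<^sup>2 / (2 * \<sigma>\<^sup>2)"
      using assms by (simp add: field_simps power2_eq_square)
    then show ?thesis
      by (simp add: normal_density_def exp_add[symmetric])
  qed
  moreover have "has_bochner_integral lborel (\<lambda>z. exp (a\<^sup>2 * \<sigma>\<^sup>2 / 2) * normal_density (a * \<sigma>\<^sup>2) \<sigma> z)
      (exp (a\<^sup>2 * \<sigma>\<^sup>2 / 2) * 1)"
    using assms integrable_normal_density[of \<sigma> "a * \<sigma>\<^sup>2"] integral_normal_density[of \<sigma> "a * \<sigma>\<^sup>2"]
    by (intro has_bochner_integral_mult_right) (simp add: has_bochner_integral_iff)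
  ultimately show ?thesis by simp
qed

text \<open>With u = \<delta> V, one time step multiplies h by 1 + u to first order, and the
  discount multiplies by exp(-u). Their product differs from 1 only to second order, as 1 - u^2 <=
  exp(-u)(1 + u) <= 1.\<close>

lemma exp_minus_mult_bound:
  fixes u :: real
  assumes "0 \<le> u"
  shows "\<bar>1 - exp (- u) * (1 + u)\<bar> \<le> u\<^sup>2"
proof -
  have "(1 - u) * (1 + u) \<le> exp (- u) * (1 + u)"
    using assms exp_ge_add_one_self[of "- u"] by (intro mult_right_mono) auto
  moreover have "exp (- u) * (1 + u) \<le> exp (- u) * exp u"
    using exp_ge_add_one_self[of u] by (intro mult_left_mono) auto
  ultimately show ?thesis
    by (auto simp: abs_le_iff exp_minus algebra_simps power2_eq_square)
qed

section \<open>Moments of the increments and their independence on a grid\<close>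

context standard_brownian_motion
begin

lemma has_bochner_integral_increment:
  fixes \<phi> :: "real \<Rightarrow> real"
  assumes "0 \<le> s" "s < t" and [measurable]: "\<phi> \<in> borel_measurable borel"
    and "has_bochner_integral lborel (\<lambda>z. normal_density 0 (sqrt (t - s)) z * \<phi> z) I"
  shows "has_bochner_integral M (\<lambda>\<omega>. \<phi> (W t \<omega> - W s \<omega>)) I"
  using assms distributed_integrable[OF gaussian_increments[OF assms(1,2)], of \<phi>]
    distributed_integral[OF gaussian_increments[OF assms(1,2)], of \<phi>]
  by (simp add: has_bochner_integral_iff)

lemma
  assumes st: "0 \<le> s" "s < t"
  shows increment_moment_1: "has_bochner_integral M (\<lambda>\<omega>. W t \<omega> - W s \<omega>) 0"
    and increment_moment_2: "has_bochner_integral M (\<lambda>\<omega>. (W t \<omega> - W s \<omega>)\<^sup>2) (t - s)"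
    and increment_abs_moment_3:
      "has_bochner_integral M (\<lambda>\<omega>. \<bar>W t \<omega> - W s \<omega>\<bar> ^ 3) (2 * sqrt (t - s) ^ 3 * sqrt (2 / pi))"
    and increment_mgf:
      "has_bochner_integral M (\<lambda>\<omega>. exp (a * (W t \<omega> - W s \<omega>))) (exp (a\<^sup>2 * (t - s) / 2))"
proof -
  have \<sigma>: "0 < sqrt (t - s)" using st by simp
  show "has_bochner_integral M (\<lambda>\<omega>. W t \<omega> - W s \<omega>) 0"
    using normal_moment_odd[OF \<sigma>, of 0 0]
    by (intro has_bochner_integral_increment[OF st]) simp_all
  show "has_bochner_integral M (\<lambda>\<omega>. (W t \<omega> - W s \<omega>)\<^sup>2) (t - s)"
    using normal_moment_even[OF \<sigma>, of 0 1] st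
    by (intro has_bochner_integral_increment[OF st]) (simp_all add: diff_divide_distrib)
  show "has_bochner_integral M (\<lambda>\<omega>. \<bar>W t \<omega> - W s \<omega>\<bar> ^ 3) (2 * sqrt (t - s) ^ 3 * sqrt (2 / pi))"
    using normal_moment_abs_odd[OF \<sigma>, of 0 1] st
    by (intro has_bochner_integral_increment[OF st, of "\<lambda>z. \<bar>z\<bar> ^ 3"]) simp_all
  show "has_bochner_integral M (\<lambda>\<omega>. exp (a * (W t \<omega> - W s \<omega>))) (exp (a\<^sup>2 * (t - s) / 2))"
    using normal_density_mgf[OF \<sigma>, of a] st
    by (intro has_bochner_integral_increment[OF st, of "\<lambda>z. exp (a * z)"]) simp_all
qed

text \<open>This takes the place of the Markov property: functions of the first \<open>i\<close>
  increments jointly are independent of increment number \<open>i\<close>. It follows by grouping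
  the independent family along \<open>{..<i}\<close> and \<open>{i}\<close>.\<close>

lemma grid_indep:
  assumes "0 \<le> \<delta>" and [measurable]: "G \<in> borel_measurable (PiM {..<i} (\<lambda>_. borel))"
    "\<phi> \<in> borel_measurable borel"
  defines "\<Delta> \<equiv> \<lambda>j \<omega>. W (real (Suc j) * \<delta>) \<omega> - W (real j * \<delta>) \<omega>"
  shows "indep_var borel (\<lambda>\<omega>. G (\<lambda>j\<in>{..<i}. \<Delta> j \<omega>) :: real) borel (\<lambda>\<omega>. \<phi> (\<Delta> i \<omega>) :: real)"
proof -
  have "mono_on {..Suc i} (\<lambda>j. real j * \<delta>)"
    using assms(1) by (auto simp: mono_on_def intro!: mult_right_mono)
  from independent_increments[OF _ this]
  have "indep_vars (\<lambda>_. borel) (\<lambda>j \<omega>. \<Delta> j \<omega>) {..<Suc i}"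
    by (simp add: \<Delta>_def)
  then have "indep_var (PiM {..<i} (\<lambda>_. borel)) (\<lambda>\<omega>. restrict (\<lambda>j. \<Delta> j \<omega>) {..<i})
      (PiM {i} (\<lambda>_. borel)) (\<lambda>\<omega>. restrict (\<lambda>j. \<Delta> j \<omega>) {i})"
    by (rule indep_var_restrict) auto
  from indep_var_compose[OF this, of G borel "\<lambda>f. \<phi> (f i)" borel]
  show ?thesis by (simp add: comp_def)
qed

end

section \<open>The Feynman-Kac formula at a fixed time\<close>

lemma (in prob_space) abs_expectation_le:
  fixes f :: "'a \<Rightarrow> real"
  assumes "integrable M f" "\<And>\<omega>. \<omega> \<in> space M \<Longrightarrow> \<bar>f \<omega>\<bar> \<le> c"
  shows "\<bar>expectation f\<bar> \<le> c"
proof -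
  have "\<bar>expectation f\<bar> \<le> expectation (\<lambda>\<omega>. \<bar>f \<omega>\<bar>)"
    by (rule integral_abs_bound)
  also have "\<dots> \<le> expectation (\<lambda>_. c)"
    using assms by (intro integral_mono) auto
  finally show ?thesis by (simp add: prob_space)
qed

text \<open>Convexity of the cube, through an explicit identity. It separates the Gaussian part of
  an increment from its drift in the Taylor remainder.\<close>

lemma abs_add_cube_le:
  fixes u w :: real
  shows "\<bar>u + w\<bar> ^ 3 \<le> 4 * (\<bar>u\<bar> ^ 3 + \<bar>w\<bar> ^ 3)"
proof -
  have "(\<bar>u\<bar> + \<bar>w\<bar>) ^ 3 + 3 * (\<bar>u\<bar> + \<bar>w\<bar>) * (\<bar>u\<bar> - \<bar>w\<bar>)\<^sup>2 = 4 * (\<bar>u\<bar> ^ 3 + \<bar>w\<bar> ^ 3)"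
    by (simp add: power2_eq_square power3_eq_cube algebra_simps)
  moreover have "0 \<le> 3 * (\<bar>u\<bar> + \<bar>w\<bar>) * (\<bar>u\<bar> - \<bar>w\<bar>)\<^sup>2"
    by simp
  moreover have "\<bar>u + w\<bar> ^ 3 \<le> (\<bar>u\<bar> + \<bar>w\<bar>) ^ 3"
    by (intro power_mono) auto
  ultimately show ?thesis by linarith
qed

text \<open>Among \<open>h\<close> and its derivatives only \<open>h\<close> is assumed bounded,
  because the hypergeometric series bounds F but gives no bound on F' near v = 1.\<close>

locale feynman_kac = standard_brownian_motion M W
  for M :: "'a measure" and W :: "real \<Rightarrow> 'a \<Rightarrow> real" +
  fixes x \<mu> CV CV' Ch :: real and V V' h h' :: "real \<Rightarrow> real"
  assumes mu_nonneg: "0 \<le> \<mu>"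
    and DERIV_V: "\<And>y. (V has_real_derivative V' y) (at y)"
    and V_nonneg: "\<And>y. 0 \<le> V y"
    and V_le: "\<And>y. V y \<le> CV"
    and V'_le: "\<And>y. \<bar>V' y\<bar> \<le> CV'"
    and DERIV_h: "\<And>y. (h has_real_derivative h' y) (at y)"
    and DERIV_h': "\<And>y. (h' has_real_derivative 2 * (V y * h y - \<mu> * h' y)) (at y)"
    and h_le: "\<And>y. \<bar>h y\<bar> \<le> Ch"
begin

text \<open>\<open>W 0\<close> vanishes only almost surely; subtracting it makes \<open>B\<close> on a grid a function of the
  increments of \<open>W\<close> for every outcome.\<close>

definition B :: "real \<Rightarrow> 'a \<Rightarrow> real" where
  "B t \<omega> = x + (W t \<omega> - W 0 \<omega>) + \<mu> * t"

definition h'' :: "real \<Rightarrow> real" where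
  "h'' y = 2 * (V y * h y - \<mu> * h' y)"

lemma DERIV_h'': "(h'' has_real_derivative 2 * (V' y * h y + V y * h' y - \<mu> * h'' y)) (at y)"
  unfolding h''_def
  by (auto intro!: derivative_eq_intros DERIV_V DERIV_h DERIV_h' simp: algebra_simps)

lemma isCont: "isCont V y" "isCont h y" "isCont h' y" "isCont h'' y"
  using DERIV_V DERIV_h DERIV_h' DERIV_h'' by (blast intro: DERIV_isCont)+

lemma continuous_on_V: "continuous_on UNIV V"
  by (simp add: continuous_at_imp_continuous_on isCont)

lemma borel [measurable]:
  "V \<in> borel_measurable borel" "h \<in> borel_measurable borel" "h' \<in> borel_measurable borel"
  "h'' \<in> borel_measurable borel"
  using isCont by (auto intro!: borel_measurable_continuous_onI simp: continuous_at_imp_continuous_on)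

lemma B_measurable: "0 \<le> t \<Longrightarrow> B t \<in> borel_measurable M"
  using random_variable_W[of t] random_variable_W[of 0] unfolding B_def[abs_def] by measurable

lemma grid_B_measurable [measurable]: "0 \<le> \<delta> \<Longrightarrow> B (real i * \<delta>) \<in> borel_measurable M"
  by (rule B_measurable) simp

lemma continuous_V_B:
  assumes "\<omega> \<in> space M"
  shows "continuous_on {0..} (\<lambda>s. V (B s \<omega>))"
proof -
  have "continuous_on {0..} (\<lambda>s. B s \<omega>)"
    unfolding B_def by (intro continuous_intros continuous_paths[OF assms])
  then show ?thesis
    by (rule continuous_on_compose2[OF continuous_on_V]) simp
qed

text \<open>The equation for \<open>h\<close> reads \<open>(exp (2 * \<mu> * y) * h' y)' = 2 * exp (2 * \<mu> * y) * V y * h y\<close>, so a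
  bound at some point of \<open>{y - 1..y}\<close>, which the mean value theorem provides, propagates to \<open>y\<close>.\<close>

lemma h'_le: "\<bar>h' y\<bar> \<le> 2 * Ch + 2 * CV * Ch"
proof -
  have nonneg: "0 \<le> CV" "0 \<le> Ch"
    using V_nonneg[of 0] V_le[of 0] h_le[of 0] by linarith+
  obtain a where a: "y - 1 < a" "a < y" "h y - h (y - 1) = (y - (y - 1)) * h' a"
    using MVT2[of "y - 1" y h h'] DERIV_h by auto
  then have ha: "\<bar>h' a\<bar> \<le> 2 * Ch"
    using h_le[of y] h_le[of "y - 1"] by simp
  have "((\<lambda>u. exp (2 * \<mu> * u) * h' u) has_real_derivative exp (2 * \<mu> * u) * (2 * (V u * h u))) (at u)" for u
    by (auto intro!: derivative_eq_intros DERIV_h' simp: algebra_simps)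
  from MVT2[OF a(2) this] obtain z where z: "a < z" "z < y"
    "exp (2 * \<mu> * y) * h' y - exp (2 * \<mu> * a) * h' a = (y - a) * (exp (2 * \<mu> * z) * (2 * (V z * h z)))"
    by auto
  have "\<bar>exp (2 * \<mu> * a) * h' a\<bar> \<le> exp (2 * \<mu> * y) * (2 * Ch)"
    unfolding abs_mult using a(2) mu_nonneg ha by (intro mult_mono) (auto intro!: mult_left_mono)
  moreover have "\<bar>(y - a) * (exp (2 * \<mu> * z) * (2 * (V z * h z)))\<bar> \<le> 1 * (exp (2 * \<mu> * y) * (2 * (CV * Ch)))"
    unfolding abs_mult using a z mu_nonneg V_nonneg[of z] V_le[of z] h_le[of z] nonneg
    by (intro mult_mono) (auto intro!: mult_left_mono)
  ultimately have "\<bar>exp (2 * \<mu> * y) * h' y\<bar> \<le> exp (2 * \<mu> * y) * (2 * Ch + 2 * CV * Ch)"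
    using z(3) by (simp add: algebra_simps)
  then show ?thesis by (simp add: abs_mult)
qed

text \<open>The equation expresses h'' through h and h', and its derivative expresses h''' through
  h, h' and h''. So the bound on h' propagates to \<open>C2\<close> and \<open>C3\<close>; the sum
  \<open>C\<close> of all constants serves every estimate at once.\<close>

lemma taylor_bounds:
  obtains C where "0 \<le> C" "\<And>y. V y \<le> C" "\<And>y. \<bar>h y\<bar> \<le> C" "\<And>y. \<bar>h' y\<bar> \<le> C" "\<And>y. \<bar>h'' y\<bar> \<le> C"
    "\<And>y d. \<bar>h (y + d) - (h y + h' y * d + h'' y / 2 * d\<^sup>2)\<bar> \<le> C * \<bar>d\<bar> ^ 3"
proof -
  define h3 where "h3 y = 2 * (V' y * h y + V y * h' y - \<mu> * h'' y)" for y
  define C1 where "C1 = 2 * Ch + 2 * CV * Ch"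
  define C2 where "C2 = 2 * (CV * Ch + \<mu> * C1)"
  define C3 where "C3 = 2 * (CV' * Ch + CV * C1 + \<mu> * C2)"
  have nonneg: "0 \<le> CV" "0 \<le> Ch" "0 \<le> CV'"
    using V_nonneg[of 0] V_le[of 0] h_le[of 0] V'_le[of 0] by linarith+
  then have C: "0 \<le> C1" "0 \<le> C2" "0 \<le> C3"
    using mu_nonneg by (auto simp: C1_def C2_def C3_def)
  have h1: "\<bar>h' y\<bar> \<le> C1" for y
    using h'_le by (simp add: C1_def)
  have prod: "\<bar>a * b\<bar> \<le> A * B" if "\<bar>a\<bar> \<le> A" "\<bar>b\<bar> \<le> B" for a b A B :: real
    unfolding abs_mult using that by (intro mult_mono) auto
  have V_abs: "\<bar>V y\<bar> \<le> CV" for y using V_nonneg[of y] V_le[of y] by simp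
  have mu_abs: "\<bar>\<mu>\<bar> \<le> \<mu>" using mu_nonneg by simp
  have h2: "\<bar>h'' y\<bar> \<le> C2" for y
    using prod[OF V_abs[of y] h_le[of y]] prod[OF mu_abs h1[of y]]
    unfolding h''_def C2_def by (auto simp: abs_le_iff)
  have h3: "\<bar>h3 y\<bar> \<le> C3" for y
    using prod[OF V'_le[of y] h_le[of y]] prod[OF V_abs[of y] h1[of y]] prod[OF mu_abs h2[of y]]
    unfolding h3_def C3_def by (auto simp: abs_le_iff)
  have taylor: "\<bar>h (y + d) - (h y + h' y * d + h'' y / 2 * d\<^sup>2)\<bar> \<le> C3 * \<bar>d\<bar> ^ 3" for y d
  proof (cases "d = 0")
    case False
    define D where "D m = (if m = 0 then h else if m = 1 then h' else if m = 2 then h'' else h3)" for m :: nat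
    have "\<forall>m t. m < 3 \<and> min y (y + d) \<le> t \<and> t \<le> max y (y + d) \<longrightarrow> DERIV (D m) t :> D (Suc m) t"
      using DERIV_h DERIV_h'[folded h''_def] DERIV_h''[folded h3_def]
      by (auto simp: D_def less_Suc_eq numeral_3_eq_3)
    from Taylor[OF _ _ this, of h y "y + d"] False obtain t where
      "h (y + d) = (\<Sum>m<3. (D m y / fact m) * (y + d - y) ^ m) + (D 3 t / fact 3) * (y + d - y) ^ 3"
      by (auto simp: D_def)
    also have "(\<Sum>m<3. (D m y / fact m) * (y + d - y) ^ m) = h y + h' y * d + h'' y / 2 * d\<^sup>2"
      by (simp add: D_def numeral_3_eq_3 power2_eq_square)
    finally have "h (y + d) - (h y + h' y * d + h'' y / 2 * d\<^sup>2) = h3 t / fact 3 * d ^ 3"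
      by (simp add: D_def)
    then have "\<bar>h (y + d) - (h y + h' y * d + h'' y / 2 * d\<^sup>2)\<bar> = \<bar>h3 t\<bar> / fact 3 * \<bar>d\<bar> ^ 3"
      by (simp add: abs_mult power_abs)
    also have "\<dots> \<le> C3 * \<bar>d\<bar> ^ 3"
      using h3[of t] C by (intro mult_right_mono) (auto simp: fact_numeral)
    finally show ?thesis .
  qed simp
  define C where "C = CV + Ch + C1 + C2 + C3"
  show ?thesis
  proof (rule that[of C])
    show "0 \<le> C" using nonneg C by (simp add: C_def)
    show "V y \<le> C" for y using V_le[of y] nonneg C by (simp add: C_def)
    show "\<bar>h y\<bar> \<le> C" for y using h_le[of y] nonneg C by (simp add: C_def)
    show "\<bar>h' y\<bar> \<le> C" for y using h1[of y] nonneg C by (simp add: C_def)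
    show "\<bar>h'' y\<bar> \<le> C" for y using h2[of y] nonneg C by (simp add: C_def)
    show "\<bar>h (y + d) - (h y + h' y * d + h'' y / 2 * d\<^sup>2)\<bar> \<le> C * \<bar>d\<bar> ^ 3" for y d
      using taylor[of y d] nonneg C
      by (elim order.trans) (auto simp: C_def intro!: mult_right_mono)
  qed
qed

section \<open>The discounted process on a time grid\<close>

definition discount :: "real \<Rightarrow> nat \<Rightarrow> 'a \<Rightarrow> real" where
  "discount \<delta> i \<omega> = exp (- (\<delta> * (\<Sum>j<i. V (B (real j * \<delta>) \<omega>))))"

lemma discount_measurable [measurable]: "0 \<le> \<delta> \<Longrightarrow> discount \<delta> i \<in> borel_measurable M"
  unfolding discount_def[abs_def] by measurable

lemma discount_pos: "0 < discount \<delta> i \<omega>"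
  by (simp add: discount_def)

lemma discount_le_1: "0 \<le> \<delta> \<Longrightarrow> discount \<delta> i \<omega> \<le> 1"
  by (simp add: discount_def V_nonneg sum_nonneg)

lemma discount_Suc: "discount \<delta> (Suc i) \<omega> = discount \<delta> i \<omega> * exp (- (\<delta> * V (B (real i * \<delta>) \<omega>)))"
  by (simp add: discount_def exp_add[symmetric] algebra_simps)

lemma integrable_discount:
  assumes "0 \<le> \<delta>" and [measurable]: "u \<in> borel_measurable borel" and "\<And>y. \<bar>u y\<bar> \<le> C"
  shows "integrable M (\<lambda>\<omega>. discount \<delta> i \<omega> * u (B (real j * \<delta>) \<omega>))"
proof (rule integrable_const_bound[of _ C])
  note [measurable] = discount_measurable[OF assms(1)] grid_B_measurable[OF assms(1)]
  show "(\<lambda>\<omega>. discount \<delta> i \<omega> * u (B (real j * \<delta>) \<omega>)) \<in> borel_measurable M"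
    by measurable
  have "\<bar>discount \<delta> i \<omega>\<bar> * \<bar>u (B (real j * \<delta>) \<omega>)\<bar> \<le> 1 * C" for \<omega>
    using assms discount_pos[of \<delta> i \<omega>] discount_le_1[of \<delta> i \<omega>] by (intro mult_mono) auto
  then show "AE \<omega> in M. norm (discount \<delta> i \<omega> * u (B (real j * \<delta>) \<omega>)) \<le> C"
    by (auto simp: abs_mult)
qed

text \<open>\<open>discount \<delta> (Suc i)\<close> involves \<open>V\<close> only at the times 0,
  ..., i\<delta>, so it and B at time i\<delta> are functions of the first \<open>i\<close>
  increments. The expectation factorises although the discount already includes the current
  step.\<close>

lemma grid_expectation:
  assumes "0 \<le> \<delta>" and [measurable]: "u \<in> borel_measurable borel" and u: "\<And>y. \<bar>u y\<bar> \<le> C"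
    and [measurable]: "\<phi> \<in> borel_measurable borel"
    and I: "has_bochner_integral M (\<lambda>\<omega>. \<phi> (W (real (Suc i) * \<delta>) \<omega> - W (real i * \<delta>) \<omega>)) I"
  shows "has_bochner_integral M (\<lambda>\<omega>. discount \<delta> (Suc i) \<omega> * u (B (real i * \<delta>) \<omega>) *
      \<phi> (W (real (Suc i) * \<delta>) \<omega> - W (real i * \<delta>) \<omega>))
    (expectation (\<lambda>\<omega>. discount \<delta> (Suc i) \<omega> * u (B (real i * \<delta>) \<omega>)) * I)"
proof -
  define \<Delta> where "\<Delta> j \<omega> = W (real (Suc j) * \<delta>) \<omega> - W (real j * \<delta>) \<omega>" for j \<omega>
  \<comment> \<open>\<open>X j\<close> rebuilds B at time j\<delta> from a list of
    increments.\<close>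
  define X where "X j f = x + (\<Sum>l<j. f l) + \<mu> * (real j * \<delta>)" for j and f :: "nat \<Rightarrow> real"
  define G where "G f = exp (- (\<delta> * (\<Sum>j<Suc i. V (X j f)))) * u (X i f)" for f
  have B_eq: "B (real j * \<delta>) \<omega> = X j (\<lambda>l\<in>{..<i}. \<Delta> l \<omega>)" if "j \<le> i" for j \<omega>
  proof -
    have "(\<Sum>l<j. (\<lambda>l\<in>{..<i}. \<Delta> l \<omega>) l) = (\<Sum>l<j. \<Delta> l \<omega>)"
      using that by (intro sum.cong) auto
    also have "\<dots> = W (real j * \<delta>) \<omega> - W 0 \<omega>"
      unfolding \<Delta>_def by (subst sum_lessThan_telescope) simp
    finally show ?thesis by (simp add: B_def X_def)
  qed
  have G_eq: "discount \<delta> (Suc i) \<omega> * u (B (real i * \<delta>) \<omega>) = G (\<lambda>l\<in>{..<i}. \<Delta> l \<omega>)" for \<omega>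
    unfolding discount_def G_def using B_eq by simp
  have X_meas: "X j \<in> borel_measurable (PiM {..<i} (\<lambda>_. borel))" if "j \<le> i" for j
    unfolding X_def using that
    by (intro borel_measurable_add borel_measurable_sum borel_measurable_const measurable_component_singleton) auto
  have G_meas: "G \<in> borel_measurable (PiM {..<i} (\<lambda>_. borel))"
  proof -
    have "(\<lambda>f. \<Sum>j<Suc i. V (X j f)) \<in> borel_measurable (PiM {..<i} (\<lambda>_. borel))"
      by (intro borel_measurable_sum measurable_compose[OF X_meas]) auto
    moreover have "(\<lambda>f. u (X i f)) \<in> borel_measurable (PiM {..<i} (\<lambda>_. borel))"
      by (intro measurable_compose[OF X_meas]) auto
    ultimately show ?thesis
      unfolding G_def by measurable
  qed
  have int: "integrable M (\<lambda>\<omega>. G (\<lambda>l\<in>{..<i}. \<Delta> l \<omega>))"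
    unfolding G_eq[symmetric] using assms by (intro integrable_discount) auto
  have int': "integrable M (\<lambda>\<omega>. \<phi> (\<Delta> i \<omega>))" "expectation (\<lambda>\<omega>. \<phi> (\<Delta> i \<omega>)) = I"
    using I by (auto simp: \<Delta>_def has_bochner_integral_iff)
  note ind = grid_indep[OF assms(1) G_meas assms(4), folded \<Delta>_def]
  show ?thesis
    unfolding G_eq \<Delta>_def[symmetric] has_bochner_integral_iff
    using indep_var_lebesgue_integral[OF ind int int'(1)] indep_var_integrable[OF ind int int'(1)] int'(2)
    by simp
qed

text \<open>Taylor expansion, with the increment of B having mean \<mu>\<delta> and second moment
  \<delta> + \<mu>^2 \<delta>^2, gives E h + \<delta> E(h''/2 + \<mu> h') up to errors. The equation
  for h makes this E(h + \<delta> V h), which the discount exp(-\<delta> V) cancels to first order.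
  The order \<delta>^(3/2) is that of the third absolute moment.\<close>

lemma discounted_step:
  obtains K where "\<And>\<delta> i. 0 < \<delta> \<Longrightarrow> \<delta> \<le> 1 \<Longrightarrow>
    \<bar>expectation (\<lambda>\<omega>. discount \<delta> (Suc i) \<omega> * h (B (real (Suc i) * \<delta>) \<omega>))
      - expectation (\<lambda>\<omega>. discount \<delta> i \<omega> * h (B (real i * \<delta>) \<omega>))\<bar> \<le> K * (\<delta> * sqrt \<delta>)"
proof -
  obtain C where C: "0 \<le> C" "\<And>y. V y \<le> C" "\<And>y. \<bar>h y\<bar> \<le> C" "\<And>y. \<bar>h' y\<bar> \<le> C" "\<And>y. \<bar>h'' y\<bar> \<le> C"
    and taylor: "\<And>y d. \<bar>h (y + d) - (h y + h' y * d + h'' y / 2 * d\<^sup>2)\<bar> \<le> C * \<bar>d\<bar> ^ 3"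
    using taylor_bounds by blast
  \<comment> \<open>The summands bound, in order, the discount error, the \<mu>^2 \<delta>^2 part of
    the second moment, and the Taylor remainder; the 4 comes from \<open>abs_add_cube_le\<close>,
    the 2 from the third absolute moment.\<close>
  define K where "K = C ^ 3 + \<mu>\<^sup>2 * C + 4 * C * (2 + \<mu> ^ 3)"
  have "\<bar>expectation (\<lambda>\<omega>. discount \<delta> (Suc i) \<omega> * h (B (real (Suc i) * \<delta>) \<omega>))
      - expectation (\<lambda>\<omega>. discount \<delta> i \<omega> * h (B (real i * \<delta>) \<omega>))\<bar> \<le> K * (\<delta> * sqrt \<delta>)"
    if \<delta>: "0 < \<delta>" "\<delta> \<le> 1" for \<delta> i
  proof -
    have \<delta>0: "0 \<le> \<delta>" using \<delta> by simp
    define a where "a = discount \<delta> (Suc i)"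
    define b where "b = discount \<delta> i"
    define X where "X = B (real i * \<delta>)"
    define \<Delta> where "\<Delta> \<omega> = W (real (Suc i) * \<delta>) \<omega> - W (real i * \<delta>) \<omega>" for \<omega>
    have diff: "real (Suc i) * \<delta> - real i * \<delta> = \<delta>" by (simp add: algebra_simps)
    have st: "0 \<le> real i * \<delta>" "real i * \<delta> < real (Suc i) * \<delta>"
      using \<delta> by simp_all
    note moments = increment_moment_1[OF st, folded \<Delta>_def]
      increment_moment_2[OF st, folded \<Delta>_def, unfolded diff]
      increment_abs_moment_3[OF st, folded \<Delta>_def, unfolded diff]
    have const: "has_bochner_integral M (\<lambda>_. r) r" for r :: real
      by (simp add: has_bochner_integral_iff prob_space)
    have I1: "has_bochner_integral M (\<lambda>\<omega>. \<Delta> \<omega> + \<mu> * \<delta>) (\<mu> * \<delta>)"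
      using has_bochner_integral_add[OF moments(1) const[of "\<mu> * \<delta>"]] by simp
    have "has_bochner_integral M (\<lambda>\<omega>. (\<Delta> \<omega>)\<^sup>2 + (2 * (\<mu> * \<delta>)) * \<Delta> \<omega> + (\<mu> * \<delta>)\<^sup>2) (\<delta> + (2 * (\<mu> * \<delta>)) * 0 + (\<mu> * \<delta>)\<^sup>2)"
      by (intro has_bochner_integral_add has_bochner_integral_mult_right moments const)
    then have I2: "has_bochner_integral M (\<lambda>\<omega>. (\<Delta> \<omega> + \<mu> * \<delta>)\<^sup>2) (\<delta> + \<mu>\<^sup>2 * \<delta>\<^sup>2)"
      by (simp add: power2_sum power_mult_distrib mult_ac add_ac)
    have int: "integrable M (\<lambda>\<omega>. a \<omega> * u (X \<omega>))" "integrable M (\<lambda>\<omega>. b \<omega> * u (X \<omega>))"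
      if "u \<in> borel_measurable borel" "\<And>y. \<bar>u y\<bar> \<le> D" for u D
      using integrable_discount[OF \<delta>0 that] by (auto simp: a_def b_def X_def)
    define E where "E u = expectation (\<lambda>\<omega>. a \<omega> * u (X \<omega>))" for u
    have grid: "has_bochner_integral M (\<lambda>\<omega>. a \<omega> * u (X \<omega>) * \<phi> (\<Delta> \<omega>)) (E u * I)"
      if "u \<in> borel_measurable borel" "\<And>y. \<bar>u y\<bar> \<le> D" "\<phi> \<in> borel_measurable borel"
        "has_bochner_integral M (\<lambda>\<omega>. \<phi> (\<Delta> \<omega>)) I" for u \<phi> I D
      using grid_expectation[OF \<delta>0 that(1,2,3) that(4)[unfolded \<Delta>_def]]
      by (simp add: a_def X_def \<Delta>_def E_def)
    \<comment> \<open>The second-order Taylor polynomial of h at the next grid point, weighted by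
      the discount. The factor 1 gives the first summand the shape that \<open>grid\<close>
      expects.\<close>
    define P where "P \<omega> = a \<omega> * h (X \<omega>) * 1 + a \<omega> * h' (X \<omega>) * (\<Delta> \<omega> + \<mu> * \<delta>)
      + a \<omega> * (h'' (X \<omega>) / 2) * (\<Delta> \<omega> + \<mu> * \<delta>)\<^sup>2" for \<omega>
    have half: "\<bar>h'' y / 2\<bar> \<le> C / 2" for y using C(5)[of y] by simp
    have P: "has_bochner_integral M P (E h * 1 + E h' * (\<mu> * \<delta>) + E (\<lambda>y. h'' y / 2) * (\<delta> + \<mu>\<^sup>2 * \<delta>\<^sup>2))"
      unfolding P_def
      by (intro has_bochner_integral_add grid[of _ C "\<lambda>_. 1"] grid[of _ C "\<lambda>z. z + \<mu> * \<delta>"]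
          grid[of "\<lambda>y. h'' y / 2" "C / 2" "\<lambda>z. (z + \<mu> * \<delta>)\<^sup>2"] C half I1 I2 const) simp_all
    have VhC: "\<bar>V y * h y\<bar> \<le> C * C" for y
      unfolding abs_mult using C(2,3)[of y] V_nonneg[of y] C(1) by (intro mult_mono) auto
    \<comment> \<open>The equation for h enters here; in \<open>EP\<close> the two terms with
      \<mu>\<delta> E h' cancel.\<close>
    have E_h'': "E (\<lambda>y. h'' y / 2) = E (\<lambda>y. V y * h y) - \<mu> * E h'"
    proof -
      have "E (\<lambda>y. h'' y / 2) = expectation (\<lambda>\<omega>. a \<omega> * (V (X \<omega>) * h (X \<omega>)) - \<mu> * (a \<omega> * h' (X \<omega>)))"
        unfolding E_def h''_def by (intro Bochner_Integration.integral_cong) (simp_all add: field_simps)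
      also have "\<dots> = E (\<lambda>y. V y * h y) - \<mu> * E h'"
        unfolding E_def using int(1)[of "\<lambda>y. V y * h y" "C * C"] int(1)[of h' C] VhC C(4)
        by (subst Bochner_Integration.integral_diff) auto
      finally show ?thesis .
    qed
    have EP: "expectation P = E h + \<delta> * E (\<lambda>y. V y * h y) + \<mu>\<^sup>2 * \<delta>\<^sup>2 * E (\<lambda>y. h'' y / 2)"
      using P unfolding has_bochner_integral_iff distrib_left E_h'' by (simp add: algebra_simps)
    have X_Suc: "B (real (Suc i) * \<delta>) \<omega> = X \<omega> + (\<Delta> \<omega> + \<mu> * \<delta>)" for \<omega>
      by (simp add: B_def X_def \<Delta>_def algebra_simps)
    have int_N: "integrable M (\<lambda>\<omega>. a \<omega> * h (B (real (Suc i) * \<delta>) \<omega>))"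
      unfolding a_def by (intro integrable_discount[OF \<delta>0 _ C(3)]) simp
    have rem_int: "integrable M (\<lambda>\<omega>. C * (4 * (\<bar>\<Delta> \<omega>\<bar> ^ 3 + (\<mu> * \<delta>) ^ 3)))"
      using moments(3) by (auto simp: has_bochner_integral_iff)
    have "\<bar>expectation (\<lambda>\<omega>. a \<omega> * h (B (real (Suc i) * \<delta>) \<omega>)) - expectation P\<bar>
        = \<bar>expectation (\<lambda>\<omega>. a \<omega> * h (B (real (Suc i) * \<delta>) \<omega>) - P \<omega>)\<bar>"
      using int_N P by (simp add: has_bochner_integral_iff)
    also have "\<dots> \<le> expectation (\<lambda>\<omega>. \<bar>a \<omega> * h (B (real (Suc i) * \<delta>) \<omega>) - P \<omega>\<bar>)"
      by (rule integral_abs_bound)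
    also have "\<dots> \<le> expectation (\<lambda>\<omega>. C * (4 * (\<bar>\<Delta> \<omega>\<bar> ^ 3 + (\<mu> * \<delta>) ^ 3)))"
    proof (rule integral_mono[OF _ rem_int])
      show "integrable M (\<lambda>\<omega>. \<bar>a \<omega> * h (B (real (Suc i) * \<delta>) \<omega>) - P \<omega>\<bar>)"
        using int_N P by (auto simp: has_bochner_integral_iff)
      fix \<omega>
      let ?D = "\<Delta> \<omega> + \<mu> * \<delta>"
      have "a \<omega> * h (B (real (Suc i) * \<delta>) \<omega>) - P \<omega>
          = a \<omega> * (h (X \<omega> + ?D) - (h (X \<omega>) + h' (X \<omega>) * ?D + h'' (X \<omega>) / 2 * ?D\<^sup>2))"
        unfolding P_def X_Suc by (simp add: algebra_simps)
      also have "\<bar>\<dots>\<bar> \<le> 1 * (C * \<bar>?D\<bar> ^ 3)"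
        unfolding a_def abs_mult[of "discount \<delta> (Suc i) \<omega>"]
        using discount_pos[of \<delta> "Suc i" \<omega>] discount_le_1[OF \<delta>0, of "Suc i" \<omega>] taylor
        by (intro mult_mono) auto
      also have "\<dots> \<le> C * (4 * (\<bar>\<Delta> \<omega>\<bar> ^ 3 + (\<mu> * \<delta>) ^ 3))"
        using abs_add_cube_le[of "\<Delta> \<omega>" "\<mu> * \<delta>"] C(1) mu_nonneg \<delta>
        by (simp add: mult_left_mono)
      finally show "\<bar>a \<omega> * h (B (real (Suc i) * \<delta>) \<omega>) - P \<omega>\<bar> \<le> C * (4 * (\<bar>\<Delta> \<omega>\<bar> ^ 3 + (\<mu> * \<delta>) ^ 3))" .
    qed
    also have "\<dots> = C * (4 * (2 * sqrt \<delta> ^ 3 * sqrt (2 / pi) + (\<mu> * \<delta>) ^ 3))"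
      using moments(3) by (auto simp: has_bochner_integral_iff prob_space)
    finally have rem: "\<bar>expectation (\<lambda>\<omega>. a \<omega> * h (B (real (Suc i) * \<delta>) \<omega>)) - expectation P\<bar>
      \<le> C * (4 * (2 * sqrt \<delta> ^ 3 * sqrt (2 / pi) + (\<mu> * \<delta>) ^ 3))" .
    \<comment> \<open>Here the discounts of steps i + 1 and i are compared: a = b exp(-u) with u =
      \<delta> V(X), so the integrand is -b h (1 - exp(-u)(1 + u)).\<close>
    have "\<bar>E h + \<delta> * E (\<lambda>y. V y * h y) - expectation (\<lambda>\<omega>. b \<omega> * h (X \<omega>))\<bar> \<le> C ^ 3 * \<delta>\<^sup>2"
    proof -
      let ?f = "\<lambda>\<omega>. a \<omega> * h (X \<omega>) + \<delta> * (a \<omega> * (V (X \<omega>) * h (X \<omega>))) - b \<omega> * h (X \<omega>)"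
      note ints = int(1)[of "\<lambda>y. V y * h y" "C * C"] int(1)[of h C] int(2)[of h C]
      have "integrable M ?f"
        using ints VhC C(3) by auto
      moreover have "E h + \<delta> * E (\<lambda>y. V y * h y) - expectation (\<lambda>\<omega>. b \<omega> * h (X \<omega>)) = expectation ?f"
        unfolding E_def using ints VhC C(3)
        by (subst Bochner_Integration.integral_diff Bochner_Integration.integral_add; auto)+
      moreover have "\<bar>?f \<omega>\<bar> \<le> C ^ 3 * \<delta>\<^sup>2" for \<omega>
      proof -
        define u where "u = \<delta> * V (X \<omega>)"
        have u: "0 \<le> u" "u \<le> \<delta> * C"
          using V_nonneg C(2) \<delta>0 by (auto simp: u_def intro: mult_left_mono)
        have "?f \<omega> = - (b \<omega> * (h (X \<omega>) * (1 - exp (- u) * (1 + u))))"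
          unfolding a_def discount_Suc b_def[symmetric] X_def[symmetric] u_def by (simp add: algebra_simps)
        then have "\<bar>?f \<omega>\<bar> = \<bar>b \<omega>\<bar> * (\<bar>h (X \<omega>)\<bar> * \<bar>1 - exp (- u) * (1 + u)\<bar>)"
          by (simp add: abs_mult)
        also have "\<dots> \<le> 1 * (C * (\<delta> * C)\<^sup>2)"
        proof (intro mult_mono)
          show "\<bar>b \<omega>\<bar> \<le> 1"
            using discount_pos[of \<delta> i \<omega>] discount_le_1[OF \<delta>0, of i \<omega>] by (simp add: b_def)
          show "\<bar>1 - exp (- u) * (1 + u)\<bar> \<le> (\<delta> * C)\<^sup>2"
            using exp_minus_mult_bound[OF u(1)] power_mono[OF u(2) u(1), of 2] by simp
        qed (use C in auto)
        finally show ?thesis by (simp add: power2_eq_square power3_eq_cube mult_ac)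
      qed
      ultimately show ?thesis
        using abs_expectation_le[of ?f "C ^ 3 * \<delta>\<^sup>2"] by simp
    qed
    moreover have "\<bar>\<mu>\<^sup>2 * \<delta>\<^sup>2 * E (\<lambda>y. h'' y / 2)\<bar> \<le> \<mu>\<^sup>2 * \<delta>\<^sup>2 * C"
    proof -
      have "\<bar>a \<omega> * (h'' (X \<omega>) / 2)\<bar> \<le> 1 * (C / 2)" for \<omega>
        unfolding abs_mult a_def
        using discount_pos[of \<delta> "Suc i" \<omega>] discount_le_1[OF \<delta>0, of "Suc i" \<omega>] half[of "X \<omega>"] C(1)
        by (intro mult_mono) auto
      then have "\<bar>E (\<lambda>y. h'' y / 2)\<bar> \<le> 1 * (C / 2)"
        unfolding E_def using int(1)[of "\<lambda>y. h'' y / 2" "C / 2"] half by (intro abs_expectation_le) auto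
      then have "\<bar>E (\<lambda>y. h'' y / 2)\<bar> \<le> C" using C(1) by simp
      then show ?thesis by (simp add: abs_mult mult_left_mono)
    qed
    ultimately have "\<bar>expectation (\<lambda>\<omega>. a \<omega> * h (B (real (Suc i) * \<delta>) \<omega>)) - expectation (\<lambda>\<omega>. b \<omega> * h (X \<omega>))\<bar>
      \<le> C ^ 3 * \<delta>\<^sup>2 + \<mu>\<^sup>2 * \<delta>\<^sup>2 * C + C * (4 * (2 * sqrt \<delta> ^ 3 * sqrt (2 / pi) + (\<mu> * \<delta>) ^ 3))"
      using rem unfolding EP by linarith
    also have "\<dots> \<le> K * (\<delta> * sqrt \<delta>)"
    proof -
      \<comment> \<open>For \<delta> <= 1 the powers \<delta>^2 and \<delta>^3 are absorbed into
        \<delta>^(3/2).\<close>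
      have "\<delta> \<le> sqrt \<delta>"
        using \<delta> by (intro real_le_rsqrt) (auto simp: power2_eq_square mult_left_le)
      then have p2: "\<delta>\<^sup>2 \<le> \<delta> * sqrt \<delta>"
        using \<delta> by (simp add: power2_eq_square)
      have "\<delta> ^ 3 \<le> \<delta>\<^sup>2"
        using \<delta> by (intro power_decreasing) auto
      with p2 have p3: "\<mu> ^ 3 * \<delta> ^ 3 \<le> \<mu> ^ 3 * (\<delta> * sqrt \<delta>)"
        using mu_nonneg by (intro mult_left_mono) auto
      have s3: "sqrt \<delta> ^ 3 = \<delta> * sqrt \<delta>"
        using \<delta> by (simp add: power3_eq_cube)
      have "sqrt (2 / pi) \<le> 1"
        using pi_gt3 by simp
      then have "2 * sqrt \<delta> ^ 3 * sqrt (2 / pi) \<le> 2 * (\<delta> * sqrt \<delta>)"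
        using \<delta> unfolding s3 by (auto intro!: mult_left_le)
      then have "C * (4 * (2 * sqrt \<delta> ^ 3 * sqrt (2 / pi) + (\<mu> * \<delta>) ^ 3))
          \<le> C * (4 * (2 * (\<delta> * sqrt \<delta>) + \<mu> ^ 3 * (\<delta> * sqrt \<delta>)))"
        using p3 C(1) by (intro mult_left_mono) (auto simp: power_mult_distrib)
      moreover have "C ^ 3 * \<delta>\<^sup>2 \<le> C ^ 3 * (\<delta> * sqrt \<delta>)"
        using p2 C(1) by (intro mult_left_mono) auto
      moreover have "\<mu>\<^sup>2 * \<delta>\<^sup>2 * C \<le> \<mu>\<^sup>2 * (\<delta> * sqrt \<delta>) * C"
        using p2 C(1) by (intro mult_left_mono mult_right_mono) auto
      ultimately show ?thesis
        unfolding K_def by (simp add: algebra_simps)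
    qed
    finally show ?thesis by (simp add: a_def b_def X_def)
  qed
  then show ?thesis using that by blast
qed

lemma B_0: "B 0 \<omega> = x"
  by (simp add: B_def)

theorem expectation_at_time:
  assumes "0 < t"
  shows "expectation (\<lambda>\<omega>. exp (- integral {0..t} (\<lambda>s. V (B s \<omega>))) * h (B t \<omega>)) = h x"
proof -
  obtain K where K: "\<And>\<delta> i. 0 < \<delta> \<Longrightarrow> \<delta> \<le> 1 \<Longrightarrow>
    \<bar>expectation (\<lambda>\<omega>. discount \<delta> (Suc i) \<omega> * h (B (real (Suc i) * \<delta>) \<omega>))
      - expectation (\<lambda>\<omega>. discount \<delta> i \<omega> * h (B (real i * \<delta>) \<omega>))\<bar> \<le> K * (\<delta> * sqrt \<delta>)"
    using discounted_step by blast
  define N where "N \<delta> i \<omega> = discount \<delta> i \<omega> * h (B (real i * \<delta>) \<omega>)" for \<delta> i \<omega>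
  have N_err: "\<bar>expectation (N \<delta> n) - h x\<bar> \<le> real n * (K * (\<delta> * sqrt \<delta>))" if "0 < \<delta>" "\<delta> \<le> 1" for \<delta> n
  proof (induction n)
    case 0
    then show ?case by (simp add: N_def[abs_def] discount_def B_0 prob_space)
  next
    case (Suc n)
    then show ?case
      using K[OF that, of n] unfolding N_def[abs_def] by (simp add: algebra_simps)
  qed
  have ev: "\<forall>\<^sub>F n in sequentially. 0 < n \<and> t / real n \<le> 1"
    using eventually_ge_at_top[of "nat \<lceil>t\<rceil> + 1"]
    by eventually_elim (auto simp: divide_simps, linarith)
  have "(\<lambda>n. expectation (N (t / real n) n) - h x) \<longlonglongrightarrow> 0"
  proof (rule Lim_null_comparison)
    show "\<forall>\<^sub>F n in sequentially. norm (expectation (N (t / real n) n) - h x) \<le> K * t * sqrt (t / real n)"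
      using ev
    proof eventually_elim
      case (elim n)
      then have "\<bar>expectation (N (t / real n) n) - h x\<bar> \<le> real n * (K * (t / real n * sqrt (t / real n)))"
        using assms by (intro N_err) auto
      then show ?case using elim by simp
    qed
    have "(\<lambda>n. K * t * sqrt (t / real n)) \<longlonglongrightarrow> K * t * sqrt 0"
      by (intro tendsto_mult tendsto_const tendsto_real_sqrt lim_const_over_n)
    then show "(\<lambda>n. K * t * sqrt (t / real n)) \<longlonglongrightarrow> 0" by simp
  qed
  then have lim1: "(\<lambda>n. expectation (N (t / real n) n)) \<longlonglongrightarrow> h x"
    by (rule LIM_zero_cancel)
  have lim_pt: "(\<lambda>n. N (t / real n) n \<omega>) \<longlonglongrightarrow> exp (- integral {0..t} (\<lambda>s. V (B s \<omega>))) * h (B t \<omega>)"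
    if "\<omega> \<in> space M" for \<omega>
  proof -
    have "(\<lambda>n. t / real n * (\<Sum>j<n. V (B (real j * (t / real n)) \<omega>))) \<longlonglongrightarrow> integral {0..t} (\<lambda>s. V (B s \<omega>))"
      by (rule riemann_sum_tendsto_integral[OF assms])
        (rule continuous_on_subset[OF continuous_V_B[OF that]], auto)
    then have "(\<lambda>n. discount (t / real n) n \<omega> * h (B t \<omega>)) \<longlonglongrightarrow> exp (- integral {0..t} (\<lambda>s. V (B s \<omega>))) * h (B t \<omega>)"
      unfolding discount_def by (intro tendsto_intros)
    \<comment> \<open>For n = 0 the convention t / 0 = 0 would put the end of the grid at 0 instead
      of t.\<close>
    moreover have "\<forall>\<^sub>F n in sequentially. discount (t / real n) n \<omega> * h (B t \<omega>) = N (t / real n) n \<omega>"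
      using eventually_gt_at_top[of 0] by eventually_elim (simp add: N_def)
    ultimately show ?thesis by (rule Lim_transform_eventually)
  qed
  have N_meas: "N (t / real n) n \<in> borel_measurable M" for n
    using integrable_discount[of "t / real n" h Ch n n] assms h_le unfolding N_def[abs_def]
    by (intro borel_measurable_integrable) simp
  have "(\<lambda>n. expectation (N (t / real n) n)) \<longlonglongrightarrow>
    expectation (\<lambda>\<omega>. exp (- integral {0..t} (\<lambda>s. V (B s \<omega>))) * h (B t \<omega>))"
  proof (rule integral_dominated_convergence[where w = "\<lambda>_. Ch"])
    show "(\<lambda>\<omega>. exp (- integral {0..t} (\<lambda>s. V (B s \<omega>))) * h (B t \<omega>)) \<in> borel_measurable M"
      by (rule borel_measurable_LIMSEQ_real[OF lim_pt N_meas])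
    show "AE \<omega> in M. norm (N (t / real n) n \<omega>) \<le> Ch" for n
    proof (rule AE_I2)
      fix \<omega>
      have "\<bar>discount (t / real n) n \<omega>\<bar> * \<bar>h (B (real n * (t / real n)) \<omega>)\<bar> \<le> 1 * Ch"
        using assms discount_pos[of "t / real n" n \<omega>] discount_le_1[of "t / real n" n \<omega>] h_le
        by (intro mult_mono) auto
      then show "norm (N (t / real n) n \<omega>) \<le> Ch" by (simp add: N_def abs_mult)
    qed
  qed (use N_meas lim_pt in auto)
  with lim1 show ?thesis by (rule LIMSEQ_unique[THEN sym])
qed

end

section \<open>The limit of infinite time\<close>

lemma incseq_integral_nonneg:
  fixes f :: "real \<Rightarrow> real"
  assumes "continuous_on {0..} f" "\<And>s. 0 \<le> s \<Longrightarrow> 0 \<le> f s"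
  shows "incseq (\<lambda>n. integral {0..real n} f)"
  by (intro incseq_SucI integral_subset_le)
     (auto intro!: integrable_continuous_interval continuous_on_subset[OF assms(1)] assms(2))

text \<open>This covers divergent integrals as well: both sides then take the default value 0. Hence
  the half-line integral is measurable in the outcome on the whole space, exceptional paths
  included.\<close>

lemma set_integral_eq_SUP:
  fixes f :: "real \<Rightarrow> real"
  assumes f: "continuous_on {0..} f" "\<And>s. 0 \<le> s \<Longrightarrow> 0 \<le> f s"
  shows "(LINT s:{0..}|lborel. f s) = enn2real (SUP n. ennreal (integral {0..real n} f))"
proof -
  let ?g = "\<lambda>n s. ennreal (indicator {0..real n} s * f s)"
  have meas: "(\<lambda>s. indicator A s * f s) \<in> borel_measurable lborel" if "A \<in> sets borel" "A \<subseteq> {0..}" for A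
    using borel_measurable_continuous_on_indicator[OF that(1) continuous_on_subset[OF f(1) that(2)]] by simp
  have "(\<integral>\<^sup>+ s. ?g n s \<partial>lborel) = ennreal (integral {0..real n} f)" for n
  proof -
    have si: "set_integrable lborel {0..real n} f"
      by (intro borel_integrable_atLeastAtMost' continuous_on_subset[OF f(1)]) auto
    then have "(\<integral>\<^sup>+ s. ?g n s \<partial>lborel) = ennreal (LINT s:{0..real n}|lborel. f s)"
      unfolding set_lebesgue_integral_def set_integrable_def
      using f(2) by (subst nn_integral_eq_integral) (auto split: split_indicator)
    with set_borel_integral_eq_integral(2)[OF si] show ?thesis by simp
  qed
  moreover have "(\<integral>\<^sup>+ s. (SUP n. ?g n s) \<partial>lborel) = (SUP n. \<integral>\<^sup>+ s. ?g n s \<partial>lborel)"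
    using f(2) meas
    by (intro nn_integral_monotone_convergence_SUP measurable_compose[OF meas measurable_ennreal])
       (auto simp: incseq_def le_fun_def split: split_indicator)
  moreover have "(SUP n. ?g n s) = ennreal (indicator {0..} s * f s)" for s
  proof (rule antisym)
    show "(SUP n. ?g n s) \<le> ennreal (indicator {0..} s * f s)"
      using f(2) by (intro SUP_least) (auto split: split_indicator)
    show "ennreal (indicator {0..} s * f s) \<le> (SUP n. ?g n s)"
      using real_nat_ceiling_ge[of s]
      by (intro SUP_upper2[of "nat \<lceil>s\<rceil>"]) (auto split: split_indicator)
  qed
  ultimately have "(\<integral>\<^sup>+ s. ennreal (indicator {0..} s * f s) \<partial>lborel)
      = (SUP n. ennreal (integral {0..real n} f))"
    by simp
  then show ?thesis
    unfolding set_lebesgue_integral_def using meas[of "{0..}"] f(2)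
    by (subst integral_eq_nn_integral) (auto split: split_indicator)
qed

lemma integral_tendsto_set_integral:
  fixes f :: "real \<Rightarrow> real"
  assumes f: "continuous_on {0..} f" "\<And>s. 0 \<le> s \<Longrightarrow> 0 \<le> f s"
    and fin: "(SUP n. ennreal (integral {0..real n} f)) \<noteq> \<infinity>"
  shows "(\<lambda>n. integral {0..real n} f) \<longlonglongrightarrow> (LINT s:{0..}|lborel. f s)"
proof -
  define S where "S = (SUP n. ennreal (integral {0..real n} f))"
  have "(\<lambda>n. ennreal (integral {0..real n} f)) \<longlonglongrightarrow> S"
    unfolding S_def using incseq_integral_nonneg[OF f]
    by (intro LIMSEQ_SUP) (auto simp: incseq_def intro: ennreal_leI)
  moreover have "S = ennreal (enn2real S)"
    using fin unfolding S_def[symmetric] by (cases S) auto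
  ultimately have "(\<lambda>n. enn2real (ennreal (integral {0..real n} f))) \<longlonglongrightarrow> enn2real S"
    by (intro tendsto_enn2real) simp_all
  moreover have "0 \<le> integral {0..real n} f" for n
    using f(2) by (intro integral_nonneg integrable_continuous_interval continuous_on_subset[OF f(1)]) auto
  ultimately show ?thesis
    by (simp add: set_integral_eq_SUP[OF f] S_def)
qed

text \<open>Riemann sums are finite sums of random variables and converge at every outcome, so the
  limit is measurable without completeness of \<open>M\<close>.\<close>

lemma path_integral_measurable:
  fixes Y :: "real \<Rightarrow> 'a \<Rightarrow> real"
  assumes Y: "\<And>s. 0 \<le> s \<Longrightarrow> Y s \<in> borel_measurable M"
    and cont: "\<And>\<omega>. \<omega> \<in> space M \<Longrightarrow> continuous_on {0..} (\<lambda>s. Y s \<omega>)"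
    and "0 \<le> t"
  shows "(\<lambda>\<omega>. integral {0..t} (\<lambda>s. Y s \<omega>)) \<in> borel_measurable M"
proof (cases "t = 0")
  case False
  with \<open>0 \<le> t\<close> have t: "0 < t" by simp
  show ?thesis
  proof (rule borel_measurable_LIMSEQ_real)
    fix \<omega> assume \<omega>: "\<omega> \<in> space M"
    show "(\<lambda>n. t / real n * (\<Sum>j<n. Y (real j * (t / real n)) \<omega>)) \<longlonglongrightarrow> integral {0..t} (\<lambda>s. Y s \<omega>)"
      by (rule riemann_sum_tendsto_integral[OF t continuous_on_subset[OF cont[OF \<omega>]]]) auto
  next
    show "(\<lambda>\<omega>. t / real n * (\<Sum>j<n. Y (real j * (t / real n)) \<omega>)) \<in> borel_measurable M" for n
      using t by (intro borel_measurable_times borel_measurable_sum borel_measurable_const Y) auto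
  qed
qed simp

lemma set_path_integral_measurable:
  fixes Y :: "real \<Rightarrow> 'a \<Rightarrow> real"
  assumes Y: "\<And>s. 0 \<le> s \<Longrightarrow> Y s \<in> borel_measurable M"
    and cont: "\<And>\<omega>. \<omega> \<in> space M \<Longrightarrow> continuous_on {0..} (\<lambda>s. Y s \<omega>)"
    and nonneg: "\<And>s \<omega>. 0 \<le> Y s \<omega>"
  shows "(\<lambda>\<omega>. LINT s:{0..}|lborel. Y s \<omega>) \<in> borel_measurable M"
proof -
  have [measurable]: "(\<lambda>\<omega>. integral {0..real n} (\<lambda>s. Y s \<omega>)) \<in> borel_measurable M" for n
    by (rule path_integral_measurable[OF Y cont]) auto
  have "(\<lambda>\<omega>. LINT s:{0..}|lborel. Y s \<omega>) \<in> borel_measurable M \<longleftrightarrow>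
      (\<lambda>\<omega>. enn2real (SUP n. ennreal (integral {0..real n} (\<lambda>s. Y s \<omega>)))) \<in> borel_measurable M"
    by (intro measurable_cong set_integral_eq_SUP cont nonneg)
  then show ?thesis by simp
qed

lemma exp_integral_le:
  fixes \<kappa> t :: real
  assumes "0 < \<kappa>" "0 \<le> t"
  shows "integral {0..t} (\<lambda>s. exp (- \<kappa> * s)) \<le> 1 / \<kappa>"
proof -
  have "((\<lambda>s. exp (- \<kappa> * s)) has_integral (- exp (- \<kappa> * t) / \<kappa>) - (- exp (- \<kappa> * 0) / \<kappa>)) {0..t}"
    using assms
    by (intro fundamental_theorem_of_calculus)
       (auto intro!: derivative_eq_intros simp: has_real_derivative_iff_has_vector_derivative[symmetric])
  then have "integral {0..t} (\<lambda>s. exp (- \<kappa> * s)) = 1 / \<kappa> - exp (- \<kappa> * t) / \<kappa>"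
    by (simp add: integral_unique)
  then show ?thesis using assms by simp
qed

section \<open>Exponential moments and escape to infinity\<close>

context feynman_kac
begin

lemma path_integral_V_measurable:
  "0 \<le> t \<Longrightarrow> (\<lambda>\<omega>. integral {0..t} (\<lambda>s. V (B s \<omega>))) \<in> borel_measurable M"
  using B_measurable by (intro path_integral_measurable continuous_V_B) measurable

lemma path_integral_V_nonneg: "\<omega> \<in> space M \<Longrightarrow> 0 \<le> integral {0..t} (\<lambda>s. V (B s \<omega>))"
  using V_nonneg
  by (intro integral_nonneg integrable_continuous_interval continuous_on_subset[OF continuous_V_B]) auto

lemma B_mgf:
  assumes "0 \<le> t"
  shows "has_bochner_integral M (\<lambda>\<omega>. exp (- \<epsilon> * B t \<omega>)) (exp (- \<epsilon> * x) * exp (- (\<epsilon> * \<mu> - \<epsilon>\<^sup>2 / 2) * t))"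
proof (cases "t = 0")
  case False
  with assms have "0 < t" by simp
  from has_bochner_integral_mult_right[OF increment_mgf[OF order.refl this, of "- \<epsilon>"],
      of "exp (- \<epsilon> * x - \<epsilon> * \<mu> * t)"]
  show ?thesis
    by (simp add: B_def exp_add[symmetric] algebra_simps)
qed (simp add: B_0 has_bochner_integral_iff prob_space)

text \<open>The bound is uniform in t. Expectation and time integral are interchanged on Riemann
  sums, where linearity suffices, and dominated convergence passes to the limit on the left; this
  avoids joint measurability of the process.\<close>

lemma expectation_path_integral_le:
  assumes \<kappa>: "0 < \<epsilon> * \<mu> - \<epsilon>\<^sup>2 / 2" and D: "\<And>y. V y \<le> D * exp (- \<epsilon> * y)" and t: "0 < t"
  shows "expectation (\<lambda>\<omega>. integral {0..t} (\<lambda>s. V (B s \<omega>))) \<le> D * exp (- \<epsilon> * x) / (\<epsilon> * \<mu> - \<epsilon>\<^sup>2 / 2)"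
proof -
  define \<kappa> where "\<kappa> = \<epsilon> * \<mu> - \<epsilon>\<^sup>2 / 2"
  have "0 \<le> D * exp (- \<epsilon> * 0)" using D[of 0] V_nonneg[of 0] by linarith
  then have D0: "0 \<le> D" by simp
  define R where "R n \<omega> = t / real n * (\<Sum>j<n. V (B (real j * (t / real n)) \<omega>))" for n \<omega>
  have V_int: "integrable M (\<lambda>\<omega>. V (B s \<omega>))" if "0 \<le> s" for s
    using V_nonneg V_le B_measurable[OF that] by (intro integrable_const_bound[of _ CV]) auto
  have EV: "expectation (\<lambda>\<omega>. V (B s \<omega>)) \<le> D * exp (- \<epsilon> * x) * exp (- \<kappa> * s)" if "0 \<le> s" for s
  proof -
    have "expectation (\<lambda>\<omega>. V (B s \<omega>)) \<le> expectation (\<lambda>\<omega>. D * exp (- \<epsilon> * B s \<omega>))"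
      using B_mgf[OF that, of \<epsilon>] D V_int[OF that]
      by (intro integral_mono) (auto simp: has_bochner_integral_iff)
    then show ?thesis
      using B_mgf[OF that, of \<epsilon>] by (simp add: has_bochner_integral_iff \<kappa>_def)
  qed
  have R_meas: "R n \<in> borel_measurable M" for n
    unfolding R_def[abs_def] using t B_measurable
    by (intro borel_measurable_times borel_measurable_sum borel_measurable_const
        measurable_compose[OF _ borel(1)]) auto
  have "(\<lambda>n. expectation (R n)) \<longlonglongrightarrow> expectation (\<lambda>\<omega>. integral {0..t} (\<lambda>s. V (B s \<omega>)))"
  proof (rule integral_dominated_convergence[where w = "\<lambda>_. t * CV"])
    show "AE \<omega> in M. (\<lambda>n. R n \<omega>) \<longlonglongrightarrow> integral {0..t} (\<lambda>s. V (B s \<omega>))"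
      unfolding R_def
      by (intro AE_I2 riemann_sum_tendsto_integral t continuous_on_subset[OF continuous_V_B]) auto
    show "AE \<omega> in M. norm (R n \<omega>) \<le> t * CV" for n
    proof (rule AE_I2)
      fix \<omega>
      have "(\<Sum>j<n. V (B (real j * (t / real n)) \<omega>)) \<le> real n * CV"
        using V_le by (intro order.trans[OF sum_bounded_above]) auto
      then have "R n \<omega> \<le> t / real n * (real n * CV)"
        unfolding R_def using t by (intro mult_left_mono) auto
      also have "\<dots> \<le> t * CV"
        using t V_nonneg[of 0] V_le[of 0] by auto
      finally show "norm (R n \<omega>) \<le> t * CV"
        using t V_nonneg by (simp add: R_def sum_nonneg)
    qed
  qed (use t R_meas path_integral_V_measurable in auto)
  moreover have "(\<lambda>n. t / real n * (\<Sum>j<n. exp (- \<kappa> * (real j * (t / real n)))))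
      \<longlonglongrightarrow> integral {0..t} (\<lambda>s. exp (- \<kappa> * s))"
    by (rule riemann_sum_tendsto_integral[OF t]) (intro continuous_intros)
  then have "(\<lambda>n. D * exp (- \<epsilon> * x) * (t / real n * (\<Sum>j<n. exp (- \<kappa> * (real j * (t / real n))))))
      \<longlonglongrightarrow> D * exp (- \<epsilon> * x) * integral {0..t} (\<lambda>s. exp (- \<kappa> * s))"
    by (rule tendsto_mult_left)
  moreover have "expectation (R n)
      \<le> D * exp (- \<epsilon> * x) * (t / real n * (\<Sum>j<n. exp (- \<kappa> * (real j * (t / real n)))))" for n
  proof -
    have "expectation (R n) = t / real n * (\<Sum>j<n. expectation (\<lambda>\<omega>. V (B (real j * (t / real n)) \<omega>)))"
      unfolding R_def[abs_def] using V_int t by simp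
    also have "\<dots> \<le> t / real n * (\<Sum>j<n. D * exp (- \<epsilon> * x) * exp (- \<kappa> * (real j * (t / real n))))"
      using t by (intro mult_left_mono sum_mono EV) auto
    finally show ?thesis
      by (simp add: sum_distrib_left mult_ac)
  qed
  ultimately have "expectation (\<lambda>\<omega>. integral {0..t} (\<lambda>s. V (B s \<omega>)))
      \<le> D * exp (- \<epsilon> * x) * integral {0..t} (\<lambda>s. exp (- \<kappa> * s))"
    by (intro LIMSEQ_le) auto
  also have "\<dots> \<le> D * exp (- \<epsilon> * x) * (1 / \<kappa>)"
    using D0 \<kappa> t by (intro mult_left_mono exp_integral_le) (auto simp: \<kappa>_def)
  finally show ?thesis by (simp add: \<kappa>_def)
qed

text \<open>By monotone convergence the supremum of the truncated integrals has finite expectation,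
  so it is finite almost surely; this rules out the default value of the half-line integral.\<close>

lemma AE_path_integral_tendsto:
  assumes \<kappa>: "0 < \<epsilon> * \<mu> - \<epsilon>\<^sup>2 / 2" and D: "\<And>y. V y \<le> D * exp (- \<epsilon> * y)"
  shows "AE \<omega> in M. (\<lambda>n. integral {0..real n} (\<lambda>s. V (B s \<omega>))) \<longlonglongrightarrow> (LINT s:{0..}|lborel. V (B s \<omega>))"
proof -
  define A where "A n \<omega> = integral {0..real n} (\<lambda>s. V (B s \<omega>))" for n \<omega>
  define c where "c = D * exp (- \<epsilon> * x) / (\<epsilon> * \<mu> - \<epsilon>\<^sup>2 / 2)"
  have A_meas [measurable]: "A n \<in> borel_measurable M" for n
    unfolding A_def[abs_def] by (rule path_integral_V_measurable) simp
  have "(\<integral>\<^sup>+ \<omega>. ennreal (A n \<omega>) \<partial>M) \<le> ennreal c" for n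
  proof (cases "n = 0")
    case False
    have "integrable M (A n)"
    proof (rule integrable_const_bound[of _ "CV * real n"])
      show "AE \<omega> in M. norm (A n \<omega>) \<le> CV * real n"
      proof (rule AE_I2)
        fix \<omega> assume "\<omega> \<in> space M"
        then have "norm (A n \<omega>) \<le> CV * (real n - 0)"
          unfolding A_def using V_le V_nonneg
          by (intro integral_bound continuous_on_subset[OF continuous_V_B]) auto
        then show "norm (A n \<omega>) \<le> CV * real n" by simp
      qed
    qed simp
    then have "(\<integral>\<^sup>+ \<omega>. ennreal (A n \<omega>) \<partial>M) = ennreal (expectation (A n))"
      by (rule nn_integral_eq_integral) (auto simp: A_def path_integral_V_nonneg)
    also have "\<dots> \<le> ennreal c"
      using expectation_path_integral_le[OF \<kappa> D, of "real n"] False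
      by (intro ennreal_leI) (simp add: A_def[abs_def] c_def)
    finally show ?thesis .
  qed (simp add: A_def)
  moreover have "(\<integral>\<^sup>+ \<omega>. (SUP n. ennreal (A n \<omega>)) \<partial>M) = (SUP n. \<integral>\<^sup>+ \<omega>. ennreal (A n \<omega>) \<partial>M)"
    using incseq_integral_nonneg[OF continuous_V_B V_nonneg]
    by (intro nn_integral_monotone_convergence_SUP_AE)
       (auto simp: A_def[symmetric] incseq_Suc_iff intro: ennreal_leI)
  ultimately have "(\<integral>\<^sup>+ \<omega>. (SUP n. ennreal (A n \<omega>)) \<partial>M) \<le> ennreal c"
    by (simp add: SUP_least)
  then have "AE \<omega> in M. (SUP n. ennreal (A n \<omega>)) \<noteq> \<infinity>"
    by (intro nn_integral_noteq_infinite) (auto simp: top_unique)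
  then show ?thesis
    using AE_space
  proof eventually_elim
    case (elim \<omega>)
    then show ?case
      unfolding A_def by (intro integral_tendsto_set_integral continuous_V_B V_nonneg) auto
  qed
qed

text \<open>In place of the law of large numbers: the terms exp(-\<epsilon> B_n) have geometrically
  decaying expectations, so their sum is finite almost surely and the terms tend to 0.\<close>

lemma AE_B_at_top:
  assumes \<kappa>: "0 < \<epsilon> * \<mu> - \<epsilon>\<^sup>2 / 2" and \<epsilon>: "0 < \<epsilon>"
  shows "AE \<omega> in M. filterlim (\<lambda>n. B (real n) \<omega>) at_top sequentially"
proof -
  define \<kappa> where "\<kappa> = \<epsilon> * \<mu> - \<epsilon>\<^sup>2 / 2"
  have [measurable]: "B (real n) \<in> borel_measurable M" for n
    by (rule B_measurable) simp
  have "(\<integral>\<^sup>+ \<omega>. ennreal (exp (- \<epsilon> * B (real n) \<omega>)) \<partial>M) = ennreal (exp (- \<epsilon> * x) * exp (- \<kappa>) ^ n)" for n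
    using B_mgf[of "real n" \<epsilon>]
    by (subst nn_integral_eq_integral)
       (auto simp: has_bochner_integral_iff \<kappa>_def exp_of_nat_mult[symmetric] mult.commute)
  then have "(\<integral>\<^sup>+ \<omega>. (\<Sum>n. ennreal (exp (- \<epsilon> * B (real n) \<omega>))) \<partial>M)
      = (\<Sum>n. ennreal (exp (- \<epsilon> * x) * exp (- \<kappa>) ^ n))"
    by (subst nn_integral_suminf) auto
  also have "\<dots> = ennreal (\<Sum>n. exp (- \<epsilon> * x) * exp (- \<kappa>) ^ n)"
    using \<kappa> by (intro suminf_ennreal2 summable_mult summable_geometric) (auto simp: \<kappa>_def)
  finally have "AE \<omega> in M. (\<Sum>n. ennreal (exp (- \<epsilon> * B (real n) \<omega>))) \<noteq> \<infinity>"
    by (intro nn_integral_noteq_infinite) auto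
  then show ?thesis
  proof eventually_elim
    case (elim \<omega>)
    then have "summable (\<lambda>n. exp (- \<epsilon> * B (real n) \<omega>))"
      by (intro summable_suminf_not_top) auto
    then have lim: "(\<lambda>n. exp (- \<epsilon> * B (real n) \<omega>)) \<longlonglongrightarrow> 0"
      by (rule summable_LIMSEQ_zero)
    show ?case
      unfolding filterlim_at_top
    proof
      fix Z
      from lim have "\<forall>\<^sub>F n in sequentially. exp (- \<epsilon> * B (real n) \<omega>) < exp (- \<epsilon> * Z)"
        by (rule order_tendstoD) simp
      then show "\<forall>\<^sub>F n in sequentially. Z \<le> B (real n) \<omega>"
        by eventually_elim (use \<epsilon> in simp)
    qed
  qed
qed

text \<open>The identity at the integer times n passes to the limit by dominated convergence with
  bound \<open>Ch\<close>. The condition \<epsilon> <= \<mu> keeps the decay rate \<epsilon>\<mu> -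
  \<epsilon>^2/2 at least \<epsilon>^2/2.\<close>

theorem expectation_exp_path_integral:
  assumes \<epsilon>: "0 < \<epsilon>" "\<epsilon> \<le> \<mu>" and D: "\<And>y. V y \<le> D * exp (- \<epsilon> * y)"
    and L: "(h \<longlongrightarrow> L) at_top"
  shows "expectation (\<lambda>\<omega>. exp (- (LINT s:{0..}|lborel. V (B s \<omega>)))) * L = h x"
proof -
  have "\<epsilon> * \<epsilon> \<le> \<epsilon> * \<mu>" "0 < \<epsilon> * \<epsilon>" using \<epsilon> by simp_all
  then have \<kappa>: "0 < \<epsilon> * \<mu> - \<epsilon>\<^sup>2 / 2"
    unfolding power2_eq_square by linarith
  let ?I = "\<lambda>\<omega>. LINT s:{0..}|lborel. V (B s \<omega>)"
  let ?N = "\<lambda>n \<omega>. exp (- integral {0..real n} (\<lambda>s. V (B s \<omega>))) * h (B (real n) \<omega>)"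
  have I_meas: "?I \<in> borel_measurable M"
    using B_measurable by (intro set_path_integral_measurable continuous_V_B V_nonneg) measurable
  have N_meas: "?N n \<in> borel_measurable M" for n
    using B_measurable[of "real n"] path_integral_V_measurable[of "real n"] by measurable
  have "(\<lambda>n. expectation (?N n)) \<longlonglongrightarrow> expectation (\<lambda>\<omega>. exp (- ?I \<omega>) * L)"
  proof (rule integral_dominated_convergence[where w = "\<lambda>_. Ch"])
    show "(\<lambda>\<omega>. exp (- ?I \<omega>) * L) \<in> borel_measurable M"
      using I_meas by measurable
    show "AE \<omega> in M. (\<lambda>n. ?N n \<omega>) \<longlonglongrightarrow> exp (- ?I \<omega>) * L"
      using AE_path_integral_tendsto[OF \<kappa> D] AE_B_at_top[OF \<kappa> \<epsilon>(1)]
      by eventually_elim (intro tendsto_intros filterlim_compose[OF L])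
    show "AE \<omega> in M. norm (?N n \<omega>) \<le> Ch" for n
    proof (rule AE_I2)
      fix \<omega> assume "\<omega> \<in> space M"
      then have "\<bar>exp (- integral {0..real n} (\<lambda>s. V (B s \<omega>)))\<bar> * \<bar>h (B (real n) \<omega>)\<bar> \<le> 1 * Ch"
        using path_integral_V_nonneg h_le by (intro mult_mono) auto
      then show "norm (?N n \<omega>) \<le> Ch" by (simp add: abs_mult)
    qed
  qed (use N_meas in auto)
  moreover have "(\<lambda>n. expectation (?N n)) \<longlonglongrightarrow> h x"
    by (rule tendsto_eventually, use eventually_gt_at_top[of 0] in eventually_elim)
       (simp add: expectation_at_time)
  ultimately have "expectation (\<lambda>\<omega>. exp (- ?I \<omega>) * L) = h x"
    by (rule LIMSEQ_unique)
  then show ?thesis by simp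
qed

end

section \<open>The expectation of the exponential functional\<close>

text \<open>\<open>a\<close> and \<open>b\<close> enter the coefficients only through \<open>s = a + b\<close> and \<open>r = a * b\<close>, which are real
  also for complex conjugates.\<close>

primrec real_hyp_coeff :: "real \<Rightarrow> real \<Rightarrow> real \<Rightarrow> nat \<Rightarrow> real" where
  "real_hyp_coeff s r g 0 = 1"
| "real_hyp_coeff s r g (Suc n) =
     real_hyp_coeff s r g n * (((real n)\<^sup>2 + s * real n + r) / ((g + real n) * real (Suc n)))"

lemma hyp_coeff_eq_real:
  assumes "a + b = of_real s" "a * b = of_real r"
  shows "hyp_coeff a b (of_real g) n = of_real (real_hyp_coeff s r g n)"
proof (induction n)
  case (Suc n)
  have "(a + of_nat n) * (b + of_nat n) = (of_nat n)\<^sup>2 + (a + b) * of_nat n + a * b"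
    by (simp add: algebra_simps power2_eq_square)
  then have "(a + of_nat n) * (b + of_nat n) = of_real ((real n)\<^sup>2 + s * real n + r)"
    using assms by simp
  then show ?case
    by (simp add: hyp_coeff_Suc Suc.IH)
qed simp

lemma hypergeometric_series_real_hyp_coeff:
  fixes a b :: complex
  assumes "0 < g" "s < g" and "a + b = of_real s" "a * b = of_real r"
  shows "hypergeometric_series (real_hyp_coeff s r g) s r g"
proof
  show "real (Suc n) * (g + real n) * real_hyp_coeff s r g (Suc n)
      = ((real n)\<^sup>2 + s * real n + r) * real_hyp_coeff s r g n" for n
  proof -
    have "g + real n \<noteq> 0" "real (Suc n) \<noteq> 0"
      using assms(1) by linarith+
    then show ?thesis by (simp del: of_nat_Suc)
  qed
  have "0 < Re (of_real g - a - b)"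
    using assms(2,3) by (simp add: diff_diff_eq)
  from summable_norm_hyp_coeff[OF this] show "summable (\<lambda>n. \<bar>real_hyp_coeff s r g n\<bar>)"
    by (simp add: hyp_coeff_eq_real[OF assms(3,4)])
qed

text \<open>For negative \<open>w\<close> the root is purely imaginary, with real part 0 <=
  S.\<close>

lemma Re_csqrt_le:
  assumes "0 \<le> S" "w \<le> S\<^sup>2"
  shows "Re (csqrt (of_real w)) \<le> S"
proof (cases "0 \<le> w")
  case True
  then show ?thesis using assms by (simp add: csqrt_of_real_nonneg real_le_lsqrt)
next
  case False
  then show ?thesis using assms by (simp add: csqrt_of_real_nonpos)
qed

theorem theorem5p1:
  fixes M :: "'a measure" and B :: "real \<Rightarrow> 'a \<Rightarrow> real"
    and \<mu> c \<theta> p q x :: real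
    and \<alpha> \<beta> k K :: complex and v :: "real \<Rightarrow> real"
  assumes BM: "brownian_motion_with_drift M \<mu> x B"
    and mu_pos: "\<mu> > 0" and c_pos: "c > 0" and theta_pos: "\<theta> > 0"
    and p_nonneg: "p \<ge> 0" and pq_nonneg: "p + q \<ge> 0"
  defines "\<alpha> \<equiv> of_real (1/2 - \<mu>/\<theta> + sqrt (\<mu>\<^sup>2 + 2 * (p + q)) / \<theta>)
                 + 1/2 * csqrt (of_real (1 + 8 * q / \<theta>\<^sup>2))"
    and "\<beta> \<equiv> of_real (1/2 - \<mu>/\<theta> + sqrt (\<mu>\<^sup>2 + 2 * (p + q)) / \<theta>)
                 - 1/2 * csqrt (of_real (1 + 8 * q / \<theta>\<^sup>2))"
    and "k \<equiv> (\<alpha> + \<beta> - 1) / 2"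
    and "v \<equiv> \<lambda>y. c * exp (\<theta> * y) / (c * exp (\<theta> * y) + 1)"
    and "K \<equiv> Gamma (\<alpha> + of_real (2 * \<mu> / \<theta>)) * Gamma (\<beta> + of_real (2 * \<mu> / \<theta>))
              / (Gamma (\<alpha> + \<beta> + of_real (2 * \<mu> / \<theta>)) * Gamma (of_real (2 * \<mu> / \<theta>)))"
  shows "complex_of_real (prob_space.expectation M (\<lambda>\<omega>. exp (- I_infty c \<theta> B p q \<omega>)))
         = K * of_real (v x) powr k
             * gauss_F \<alpha> \<beta> (\<alpha> + \<beta> + of_real (2 * \<mu> / \<theta>)) (of_real (v x))"
proof -
  define S where "S = sqrt (\<mu>\<^sup>2 + 2 * (p + q))"
  \<comment> \<open>The nonnegative root of the indicial equation (\<theta> k + \<mu>)^2 = \<mu>^2 +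
    2(p + q).\<close>
  define kr where "kr = (S - \<mu>) / \<theta>"
  define m where "m = 2 * \<mu> / \<theta>"
  define s r g where "s = 2 * kr + 1" and "r = kr\<^sup>2 + kr - 2 * q / \<theta>\<^sup>2" and "g = 2 * kr + 1 + m"
  define rt where "rt = csqrt (of_real (1 + 8 * q / \<theta>\<^sup>2))"
  have S2: "S\<^sup>2 = \<mu>\<^sup>2 + 2 * (p + q)" and "\<mu> \<le> S"
    using pq_nonneg by (auto simp: S_def intro!: real_le_rsqrt)
  have m: "0 < m" using mu_pos theta_pos by (simp add: m_def)
  have kr: "0 \<le> kr" "\<theta> * kr + \<mu> = S"
    using \<open>\<mu> \<le> S\<close> theta_pos by (simp_all add: kr_def)
  have g: "0 < g" "s < g" using m kr by (simp_all add: g_def s_def)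
  have \<alpha>: "\<alpha> = of_real (kr + 1/2) + rt / 2" and \<beta>: "\<beta> = of_real (kr + 1/2) - rt / 2"
    by (simp_all add: \<alpha>_def \<beta>_def rt_def kr_def S_def diff_divide_distrib)
  have sum: "\<alpha> + \<beta> = of_real s"
    by (simp add: \<alpha> \<beta> s_def)
  have rt2: "rt\<^sup>2 = of_real (1 + 8 * q / \<theta>\<^sup>2)"
    unfolding rt_def by (rule power2_csqrt)
  have "\<alpha> * \<beta> = of_real ((kr + 1/2)\<^sup>2) - rt\<^sup>2 / 4"
    by (simp add: \<alpha> \<beta> power2_eq_square algebra_simps)
  also have "\<dots> = of_real ((kr + 1/2)\<^sup>2 - (1 + 8 * q / \<theta>\<^sup>2) / 4)"
    unfolding rt2 by simp
  also have "(kr + 1/2)\<^sup>2 - (1 + 8 * q / \<theta>\<^sup>2) / 4 = r"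
    by (simp add: r_def power2_eq_square algebra_simps add_divide_distrib)
  finally have prod: "\<alpha> * \<beta> = of_real r" .
  have \<gamma>: "\<alpha> + \<beta> + of_real m = of_real g"
    by (simp add: sum s_def g_def)
  have k: "k = of_real kr"
    by (simp add: k_def sum s_def)
  interpret f: hypergeometric_series "real_hyp_coeff s r g" s r g
    using hypergeometric_series_real_hyp_coeff[OF g sum prod] .
  note coeff = hyp_coeff_eq_real[OF sum prod, of g]

  \<comment> \<open>Rules out poles of the Gamma factors in \<open>K\<close>. From S^2 = \<mu>^2 +
    2(p + q) and p >= 0 follows 8q <= 4S^2, hence 1 + 8q/\<theta>^2 <= (1 + 2S/\<theta>)^2. So Re
    (\<beta> + m) >= kr + m - S/\<theta> = \<mu>/\<theta> > 0.\<close>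
  have Re_pos: "0 < Re (\<alpha> + of_real m)" "0 < Re (\<beta> + of_real m)"
  proof -
    have "0 \<le> Re rt" unfolding rt_def by (rule Re_csqrt)
    have "1 + 8 * q / \<theta>\<^sup>2 \<le> 1 + 4 * (S / \<theta>) + 4 * (S\<^sup>2 / \<theta>\<^sup>2)"
    proof -
      have "8 * q \<le> 4 * S\<^sup>2"
        unfolding S2 using p_nonneg by simp
      then have "8 * q / \<theta>\<^sup>2 \<le> 4 * S\<^sup>2 / \<theta>\<^sup>2"
        by (intro divide_right_mono) auto
      moreover have "0 \<le> S / \<theta>"
        using \<open>\<mu> \<le> S\<close> mu_pos theta_pos by simp
      ultimately show ?thesis by simp
    qed
    also have "\<dots> = (1 + 2 * (S / \<theta>))\<^sup>2"
      by (simp add: power2_eq_square algebra_simps)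
    finally have "Re rt \<le> 1 + 2 * (S / \<theta>)"
      unfolding rt_def using \<open>\<mu> \<le> S\<close> mu_pos theta_pos by (intro Re_csqrt_le) auto
    moreover have "kr + m = S / \<theta> + \<mu> / \<theta>" "0 < \<mu> / \<theta>"
      using mu_pos theta_pos by (auto simp: kr_def m_def field_simps)
    ultimately show "0 < Re (\<beta> + of_real m)" "0 < Re (\<alpha> + of_real m)"
      using \<open>0 \<le> Re rt\<close> kr(1) m by (auto simp: \<alpha> \<beta>)
  qed
  have rGamma_nz: "rGamma z \<noteq> 0" if "0 < Re z" for z :: complex
    using that by (auto simp: rGamma_eq_zero_iff elim!: nonpos_Ints_cases)
  have f_1: "of_real (f.f0 1) = (\<Sum>n. hyp_coeff \<alpha> \<beta> (of_real g) n)"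
    using f.abs_summable unfolding f.f0_def coeff
    by (subst suminf_of_real) (auto intro: summable_rabs_cancel)
  have "of_real (f.f0 1) * (rGamma (of_real g) * rGamma (of_real m)) = rGamma (\<alpha> + of_real m) * rGamma (\<beta> + of_real m)"
  proof -
    have "of_real g - \<alpha> - \<beta> = of_real m" "of_real g - \<alpha> = \<beta> + of_real m" "of_real g - \<beta> = \<alpha> + of_real m"
      using \<gamma> by (auto simp: algebra_simps)
    with gauss_summation[of "of_real g" \<alpha> \<beta>] g m show ?thesis
      by (simp add: f_1 mult.commute)
  qed
  then have K_f1: "K * of_real (f.f0 1) = 1"
    using rGamma_nz[OF Re_pos(1)] rGamma_nz[OF Re_pos(2)] rGamma_nz[of "of_real g"] rGamma_nz[of "of_real m"] g m
    unfolding K_def m_def[symmetric] \<gamma> Gamma_def by (simp add: field_simps)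

  interpret lp: logistic_potential c \<theta> \<mu> p q
    using c_pos theta_pos by unfold_locales
  have v_eq: "v = lp.v"
    by (simp add: v_def lp.v_def fun_eq_iff)
  define h where "h y = lp.v y powr kr * f.f0 (lp.v y)" for y
  define h' where "h' y = \<theta> * (1 - lp.v y) * lp.v y powr kr * (kr * f.f0 (lp.v y) + lp.v y * f.f1 (lp.v y))" for y
  have ode: "z * (1 - z) * f.f2 z + (2 * kr + 1 + 2 * \<mu> / \<theta> - (2 * kr + 2) * z) * f.f1 z
      = (kr\<^sup>2 + kr - 2 * q / \<theta>\<^sup>2) * f.f0 z" if "0 < z" "z < 1" for z
    using f.hypergeometric_ode[of z] that
    unfolding r_def[symmetric] m_def[symmetric] g_def[symmetric] by (simp add: s_def add.commute)
  have kr2: "(\<theta> * kr + \<mu>)\<^sup>2 = \<mu>\<^sup>2 + 2 * (p + q)"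
    unfolding kr(2) by (rule S2)
  have DERIV_h: "(h has_real_derivative h' y) (at y)"
    and DERIV_h': "(h' has_real_derivative 2 * (lp.V y * h y - \<mu> * h' y)) (at y)" for y
    using lp.ode_solution[OF kr2 f.DERIV_f0 f.DERIV_f1 ode, of y]
    unfolding h_def[abs_def] h'_def[abs_def] by simp_all
  have h_le: "\<bar>h y\<bar> \<le> (\<Sum>n. \<bar>real_hyp_coeff s r g n\<bar>)" for y
  proof -
    have "\<bar>h y\<bar> \<le> 1 * (\<Sum>n. \<bar>real_hyp_coeff s r g n\<bar>)"
      unfolding h_def abs_mult using lp.v_gt_0[of y] lp.v_lt_1[of y] kr(1)
      by (intro mult_mono f.f0_bound) (auto intro: powr_le1)
    then show ?thesis by simp
  qed
  have h_lim: "(h \<longlongrightarrow> f.f0 1) at_top"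
  proof -
    have "((\<lambda>y. f.f0 (lp.v y)) \<longlongrightarrow> f.f0 1) at_top"
      using lp.v_gt_0 lp.v_lt_1
      by (intro continuous_on_tendsto_compose[OF f.continuous_f0 lp.v_tendsto_1])
         (auto intro!: always_eventually less_imp_le)
    moreover have "((\<lambda>y. lp.v y powr kr) \<longlongrightarrow> 1 powr kr) at_top"
      by (intro tendsto_powr lp.v_tendsto_1 tendsto_const) simp
    ultimately show ?thesis
      unfolding h_def[abs_def] using tendsto_mult by fastforce
  qed

  obtain W where W: "standard_brownian_motion M W"
    and B_W: "\<And>t \<omega>. 0 \<le> t \<Longrightarrow> \<omega> \<in> space M \<Longrightarrow> B t \<omega> = x + W t \<omega> + \<mu> * t"
    using BM unfolding brownian_motion_with_drift_def by blast
  interpret standard_brownian_motion M W by (rule W)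
  interpret fk: feynman_kac M W x \<mu> "\<bar>p\<bar> + \<bar>q\<bar>" "\<theta> * (\<bar>p\<bar> + 2 * \<bar>q\<bar>)" "\<Sum>n. \<bar>real_hyp_coeff s r g n\<bar>"
    lp.V "\<lambda>y. - \<theta> * lp.v y * (1 - lp.v y) * (p + 2 * q * (1 - lp.v y))" h h'
  proof unfold_locales
    show "lp.V y \<le> \<bar>p\<bar> + \<bar>q\<bar>" for y
    proof -
      have "(\<bar>p\<bar> + \<bar>q\<bar>) * (1 - lp.v y) \<le> \<bar>p\<bar> + \<bar>q\<bar>"
        using lp.v_gt_0[of y] by (intro mult_left_le) auto
      with lp.abs_V_le[of y] show ?thesis by linarith
    qed
  qed (use mu_pos lp.DERIV_V lp.V_nonneg[OF p_nonneg pq_nonneg] lp.DERIV_V_bound DERIV_h DERIV_h' h_le in auto)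
  have B_cont: "continuous_on {0..} (\<lambda>t. B t \<omega>)" if "\<omega> \<in> space M" for \<omega>
  proof -
    have "continuous_on {0..} (\<lambda>t. x + W t \<omega> + \<mu> * t)"
      by (intro continuous_intros continuous_paths[OF that])
    then show ?thesis
      by (rule continuous_on_eq) (simp add: B_W[OF _ that])
  qed
  have B_meas: "B t \<in> borel_measurable M" if "0 \<le> t" for t
  proof -
    have "(\<lambda>\<omega>. x + W t \<omega> + \<mu> * t) \<in> borel_measurable M"
      using random_variable_W[OF that] by measurable
    then show ?thesis
      by (subst measurable_cong) (simp_all add: B_W[OF that])
  qed
  have I_eq: "I_infty c \<theta> B p q \<omega> = (LINT t:{0..}|lborel. lp.V (B t \<omega>))" for \<omega>
    by (simp add: I_infty_def lp.V_def)
  have I_meas: "I_infty c \<theta> B p q \<in> borel_measurable M"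
    unfolding I_eq[abs_def]
  proof (rule set_path_integral_measurable)
    show "continuous_on {0..} (\<lambda>t. lp.V (B t \<omega>))" if "\<omega> \<in> space M" for \<omega>
      by (rule continuous_on_compose2[OF fk.continuous_on_V B_cont[OF that]]) simp
  qed (use B_meas fk.V_nonneg in auto)
  have I_meas': "(\<lambda>\<omega>. LINT t:{0..}|lborel. lp.V (fk.B t \<omega>)) \<in> borel_measurable M"
    using fk.B_measurable by (intro set_path_integral_measurable fk.continuous_V_B fk.V_nonneg) measurable
  \<comment> \<open>\<open>B\<close> and \<open>fk.B\<close> differ by W at time 0, which vanishes
    only almost surely; equality of the integrals under almost sure equality also requires
    measurability of both integrands.\<close>
  have "expectation (\<lambda>\<omega>. exp (- I_infty c \<theta> B p q \<omega>))
      = expectation (\<lambda>\<omega>. exp (- (LINT t:{0..}|lborel. lp.V (fk.B t \<omega>))))"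
  proof (rule integral_cong_AE)
    show "AE \<omega> in M. exp (- I_infty c \<theta> B p q \<omega>) = exp (- (LINT t:{0..}|lborel. lp.V (fk.B t \<omega>)))"
      using start_zero AE_space
    proof eventually_elim
      case (elim \<omega>)
      then have "B t \<omega> = fk.B t \<omega>" if "0 \<le> t" for t
        using B_W[OF that elim(2)] by (simp add: fk.B_def)
      then show ?case
        unfolding I_eq by (intro arg_cong[of _ _ "\<lambda>z. exp (- z)"] set_lebesgue_integral_cong) auto
    qed
  qed (use I_meas I_meas' in measurable)
  \<comment> \<open>The rate min(\<theta>, \<mu>) meets both constraints: \<epsilon> <= \<theta> for
    the decay of the potential and \<epsilon> <= \<mu> for the exponential moment.\<close>
  moreover have "expectation (\<lambda>\<omega>. exp (- (LINT t:{0..}|lborel. lp.V (fk.B t \<omega>)))) * f.f0 1 = h x"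
    using mu_pos theta_pos
    by (intro fk.expectation_exp_path_integral[of "min \<theta> \<mu>", OF _ _ lp.V_exp_bound h_lim]) auto
  ultimately have E: "expectation (\<lambda>\<omega>. exp (- I_infty c \<theta> B p q \<omega>)) * f.f0 1 = h x"
    by simp
  have "of_real (expectation (\<lambda>\<omega>. exp (- I_infty c \<theta> B p q \<omega>)))
      = of_real (expectation (\<lambda>\<omega>. exp (- I_infty c \<theta> B p q \<omega>))) * (K * of_real (f.f0 1))"
    by (simp add: K_f1)
  also have "\<dots> = K * of_real (h x)"
    unfolding E[symmetric] by simp
  also have "of_real (h x) = of_real (v x) powr k * of_real (f.f0 (v x))"
    using lp.v_gt_0[of x] unfolding h_def k v_eq by (simp add: powr_of_real)
  also have "of_real (f.f0 (v x)) = gauss_F \<alpha> \<beta> (\<alpha> + \<beta> + of_real (2 * \<mu> / \<theta>)) (of_real (v x))"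
    using f.summable_f0[of "v x"] lp.v_gt_0[of x] lp.v_lt_1[of x]
    unfolding m_def[symmetric] \<gamma> gauss_F_hyp_coeff coeff f.f0_def v_eq
    by (subst suminf_of_real) auto
  finally show ?thesis by (simp add: mult.assoc)
qed

end
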